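(* Let $\alpha_1,\alpha_2\in(0,1)$ with $\alpha_1<\alpha_2$, let $C_1\ge 0$, $C_2>0$, $C_1+C_2=1$, and let $\lambda>0$. Let $N^{\alpha_1,\alpha_2}(t)=N(Y_{\alpha_1,\alpha_2}(t))$, $t\ge 0$, be the mixed-fractional Poisson process, where $N$ is a homogeneous Poisson process with intensity $\lambda$ independent of the inverse mixed stable subordinator $Y_{\alpha_1,\alpha_2}$. Then $N^{\alpha_1,\alpha_2}$ is the stochastic solution of the following system of fractional differential-difference equations, i.e. the functions $p_k^{(\alpha_1,\alpha_2)}(t)=\mathrm{P}\{N^{\alpha_1,\alpha_2}(t)=k\}$ satisfy, for $k=0,1,2,\ldots$, $$C_1\mathrm{D}_t^{\alpha_1}p_k^{(\alpha_1,\alpha_2)}(t)+C_2\mathrm{D}_t^{\alpha_2}p_k^{(\alpha_1,\alpha_2)}(t)=-\lambda\left(p_k^{(\alpha_1,\alpha_2)}(t)-p_{k-1}^{(\alpha_1,\alpha_2)}(t)\right),$$ with initial conditions $$p_0^{(\alpha_1,\alpha_2)}(0)=1,\qquad p_k^{(\alpha_1,\alpha_2)}(0)=0\ \ (k\ge 1),\qquad p_{-1}^{(\alpha_1,\alpha_2)}(t)=0.$$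
   Context: The mixed stable subordinator $L_{\alpha_1,\alpha_2}$ is the Lévy subordinator (increasing, cadlag, started from $0$, with independent stationary increments) with $\mathrm{E}e^{-sL_{\alpha_1,\alpha_2}(t)}=\exp\{-t(C_1s^{\alpha_1}+C_2s^{\alpha_2})\}$, $s\ge 0$. Its inverse is $Y_{\alpha_1,\alpha_2}(t)=\inf\{u\ge 0: L_{\alpha_1,\alpha_2}(u)>t\}$, $t\ge 0$. The fractional Caputo–Djrbashian derivative of order $\alpha\in(0,1)$ is $$\mathrm{D}_t^\alpha u(t)=\frac{1}{\Gamma(1-\alpha)}\int_0^t\frac{du(\tau)}{d\tau}\,\frac{d\tau}{(t-\tau)^\alpha}.$$ *)

theory Defs
  imports "HOL-Probability.Probability"
begin

definition cadlag_on_nonneg :: "(real \<Rightarrow> real) \<Rightarrow> bool" where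
  "cadlag_on_nonneg f \<longleftrightarrow>
     (\<forall>t\<ge>0. continuous (at_right t) f) \<and> (\<forall>t>0. \<exists>l. (f \<longlongrightarrow> l) (at_left t))"

text \<open>Processes are functions \<open>X t \<omega>\<close> of a real time \<open>t\<close>; only the times \<open>t \<ge> 0\<close> matter.
  Path properties are required of every path, as is usual when no completeness of the
  probability space is assumed.\<close>

definition levy_process :: "'a measure \<Rightarrow> (real \<Rightarrow> 'a \<Rightarrow> real) \<Rightarrow> bool" where
  "levy_process M X \<longleftrightarrow>
     prob_space M \<and>
     (\<forall>t\<ge>0. X t \<in> borel_measurable M) \<and>
     (\<forall>\<omega>\<in>space M. X 0 \<omega> = 0) \<and>
     (\<forall>\<omega>\<in>space M. cadlag_on_nonneg (\<lambda>t. X t \<omega>)) \<and>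
     (\<forall>(n::nat) (t::nat \<Rightarrow> real). 0 \<le> t 0 \<longrightarrow> incseq t \<longrightarrow>
        prob_space.indep_vars M (\<lambda>_. borel) (\<lambda>i \<omega>. X (t (Suc i)) \<omega> - X (t i) \<omega>) {..<n}) \<and>
     (\<forall>s\<ge>0. \<forall>h\<ge>0. distr M borel (\<lambda>\<omega>. X (s + h) \<omega> - X s \<omega>) = distr M borel (X h))"

definition levy_subordinator :: "'a measure \<Rightarrow> (real \<Rightarrow> 'a \<Rightarrow> real) \<Rightarrow> bool" where
  "levy_subordinator M L \<longleftrightarrow>
     levy_process M L \<and> (\<forall>\<omega>\<in>space M. mono_on {0..} (\<lambda>t. L t \<omega>))"

definition mixed_stable_subordinator ::
    "'a measure \<Rightarrow> real \<Rightarrow> real \<Rightarrow> real \<Rightarrow> real \<Rightarrow> (real \<Rightarrow> 'a \<Rightarrow> real) \<Rightarrow> bool" where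
  "mixed_stable_subordinator M \<alpha>\<^sub>1 \<alpha>\<^sub>2 C\<^sub>1 C\<^sub>2 L \<longleftrightarrow>
     levy_subordinator M L \<and>
     (\<forall>t\<ge>0. \<forall>s\<ge>0. prob_space.expectation M (\<lambda>\<omega>. exp (- s * L t \<omega>)) =
        exp (- t * (C\<^sub>1 * s powr \<alpha>\<^sub>1 + C\<^sub>2 * s powr \<alpha>\<^sub>2)))"

text \<open>The infimum is taken in the extended reals, so that a path which never exceeds \<open>t\<close>
  has \<open>Y(t) = \<infinity>\<close>.\<close>

definition inverse_subordinator :: "(real \<Rightarrow> 'a \<Rightarrow> real) \<Rightarrow> real \<Rightarrow> 'a \<Rightarrow> ereal" where
  "inverse_subordinator L t \<omega> = (INF u\<in>{u. 0 \<le> u \<and> t < L u \<omega>}. ereal u)"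

text \<open>The marginal law is prescribed for \<open>t > 0\<close> because \<open>poisson_pmf\<close> needs a positive rate;
  \<open>N 0 = 0\<close> is part of being a Levy process.\<close>

definition poisson_process :: "'a measure \<Rightarrow> real \<Rightarrow> (real \<Rightarrow> 'a \<Rightarrow> nat) \<Rightarrow> bool" where
  "poisson_process M r N \<longleftrightarrow>
     levy_process M (\<lambda>t \<omega>. real (N t \<omega>)) \<and>
     (\<forall>t>0. distr M (count_space UNIV) (N t) = measure_pmf (poisson_pmf (r * t)))"

text \<open>Independence of whole processes: of the sigma-algebras generated by the path maps
  into the product spaces over the time set \<open>[0, \<infinity>)\<close>.\<close>

definition independent_processes ::
    "'a measure \<Rightarrow> 'b measure \<Rightarrow> (real \<Rightarrow> 'a \<Rightarrow> 'b) \<Rightarrow> 'c measure \<Rightarrow> (real \<Rightarrow> 'a \<Rightarrow> 'c) \<Rightarrow> bool" where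
  "independent_processes M A X B Y \<longleftrightarrow>
     prob_space.indep_set M
       (sets (vimage_algebra (space M) (\<lambda>\<omega>. \<lambda>t\<in>{0..}. X t \<omega>) (PiM {0..} (\<lambda>_. A))))
       (sets (vimage_algebra (space M) (\<lambda>\<omega>. \<lambda>t\<in>{0..}. Y t \<omega>) (PiM {0..} (\<lambda>_. B))))"

text \<open>The value \<open>\<infinity>\<close> of the random clock, a null event for the inverse mixed stable
  subordinator, is sent to time \<open>0\<close> by \<open>real_of_ereal\<close>.\<close>

definition time_changed ::
    "(real \<Rightarrow> 'a \<Rightarrow> nat) \<Rightarrow> (real \<Rightarrow> 'a \<Rightarrow> ereal) \<Rightarrow> real \<Rightarrow> 'a \<Rightarrow> nat" where
  "time_changed N Y t \<omega> = N (real_of_ereal (Y t \<omega>)) \<omega>"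

text \<open>States are integers so that \<open>p\<close> at \<open>k = - 1\<close> makes sense.\<close>

definition state_prob :: "'a measure \<Rightarrow> (real \<Rightarrow> 'a \<Rightarrow> nat) \<Rightarrow> int \<Rightarrow> real \<Rightarrow> real" where
  "state_prob M X k t = measure M {\<omega> \<in> space M. int (X t \<omega>) = k}"

definition caputo :: "real \<Rightarrow> (real \<Rightarrow> real) \<Rightarrow> real \<Rightarrow> real" where
  "caputo \<alpha> u t =
     1 / Gamma (1 - \<alpha>) * (LINT \<tau>:{0<..<t}|lborel. deriv u \<tau> / (t - \<tau>) powr \<alpha>)"

text \<open>Both \<open>deriv\<close> and the Lebesgue integral are total functions, so existence of the
  Caputo-Djrbashian derivative has to be stated separately.  The condition makes
  \<open>u\<close> absolutely continuous on \<open>[0, t]\<close>.\<close>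

definition caputo_differentiable :: "real \<Rightarrow> (real \<Rightarrow> real) \<Rightarrow> real \<Rightarrow> bool" where
  "caputo_differentiable \<alpha> u t \<longleftrightarrow>
     continuous_on {0..t} u \<and>
     (\<forall>\<tau>\<in>{0<..<t}. u differentiable (at \<tau>)) \<and>
     set_integrable lborel {0<..<t} (\<lambda>\<tau>. deriv u \<tau> / (t - \<tau>) powr \<alpha>)"

end

theory Submission
  imports Defs
begin

text \<open>Write \<open>\<phi>(s) = C\<^sub>1 s\<^bsup>\<alpha>\<^sub>1\<^esup> + C\<^sub>2 s\<^bsup>\<alpha>\<^sub>2\<^esup>\<close>.  The event that the time-changed process exceeds
  \<open>k\<close> at time \<open>t\<close> means that \<open>L\<close>, evaluated at the \<open>(k + 1)\<close>-st jump time of \<open>N\<close> (an Erlang time),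
  has not passed \<open>t\<close>; hence the tail probability has Laplace transform
  \<open>(1 / s) (r / (r + \<phi>(s)))\<^bsup>k + 1\<^esup>\<close>.  Expanding \<open>r / (r + \<phi>(s))\<close> for large \<open>s\<close> into negative powers
  of \<open>s\<close> gives a function \<open>f\<close>, continuous on \<open>(0, \<infinity>)\<close> and \<open>O(t\<^bsup>\<alpha>\<^sub>2 - 1\<^esup>)\<close> at \<open>0\<close>, with this transform,
  and by uniqueness of Laplace transforms the tail is the primitive of the convolution power
  \<open>f\<^bsup>*(k + 1)\<^esup>\<close>.  The left-hand side of the equation is the convolution of the derivative with a kernel
  of transform \<open>\<phi>(s) / s\<close>, so the equation reduces to
  \<open>(\<phi> / s) (r / (r + \<phi>)) = (r / s) (1 - r / (r + \<phi>))\<close>.\<close>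

section \<open>Laplace transforms and convolutions\<close>

text \<open>The obstacle is regularity. The equation is claimed at every \<open>t > 0\<close> and
  through genuine derivatives, whereas the probabilistic description of a tail yields
  right-continuity in \<open>t\<close> and a transform, but no derivative. So a candidate density is
  constructed analytically, apart from the probability space, and is tied to the tail only
  afterwards. Two features of the construction shape the tools. The expansion converges only for
  \<open>s\<close> beyond some \<open>s0\<close>, so transforms are compared on such a half line;
  and equality of transforms determines functions only almost everywhere, so right-continuity is
  carried along to recover every point. The bound by a power of \<open>t\<close> near 0 is what
  makes convolution with the singular Caputo kernel converge and stay continuous.

  Tails are used in place of the state probabilities because their transforms are pure powers up to
  the factor \<open>1 / s\<close>, and because they vanish at time 0, so that each is the primitive
  of its density with no constant. State probabilities are differences of consecutive tails, and the
  system for them follows by linearity.\<close>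

definition has_laplace :: "(real \<Rightarrow> real) \<Rightarrow> real \<Rightarrow> real \<Rightarrow> bool" where
  "has_laplace f s G \<longleftrightarrow>
     has_bochner_integral lborel (\<lambda>t. indicator {0<..} t * (exp (- s * t) * f t)) G"

text \<open>This class contains the kernel of the Caputo derivative, is closed under convolution
  with the exponents \<beta> adding up when they are positive, and for \<beta> > 0 forces local
  integrability at 0.\<close>

definition weakly_singular :: "real \<Rightarrow> (real \<Rightarrow> real) \<Rightarrow> bool" where
  "weakly_singular \<beta> f \<longleftrightarrow> continuous_on {0<..} f \<and>
     (\<forall>T>0. \<exists>C. \<forall>t. 0 < t \<and> t \<le> T \<longrightarrow> \<bar>f t\<bar> \<le> C * t powr (\<beta> - 1))"

definition conv :: "(real \<Rightarrow> real) \<Rightarrow> (real \<Rightarrow> real) \<Rightarrow> real \<Rightarrow> real" where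
  "conv f g t = (LINT x:{0<..<t}|lborel. f x * g (t - x))"

lemma has_laplace_add:
  "has_laplace f s F \<Longrightarrow> has_laplace g s G \<Longrightarrow> has_laplace (\<lambda>t. f t + g t) s (F + G)"
  unfolding has_laplace_def
  by (drule (1) has_bochner_integral_add) (simp add: algebra_simps)

lemma has_laplace_diff:
  "has_laplace f s F \<Longrightarrow> has_laplace g s G \<Longrightarrow> has_laplace (\<lambda>t. f t - g t) s (F - G)"
  unfolding has_laplace_def
  by (drule (1) has_bochner_integral_diff) (simp add: algebra_simps)

lemma has_laplace_cmult:
  "has_laplace f s F \<Longrightarrow> has_laplace (\<lambda>t. c * f t) s (c * F)"
  unfolding has_laplace_def
  by (cases "c = 0") (simp_all add: mult.left_commute has_bochner_integral_mult_right has_bochner_integral_zero)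

lemma has_laplace_sum:
  "(\<And>i. i \<in> I \<Longrightarrow> has_laplace (f i) s (F i)) \<Longrightarrow> has_laplace (\<lambda>t. \<Sum>i\<in>I. f i t) s (\<Sum>i\<in>I. F i)"
  unfolding has_laplace_def by (simp add: sum_distrib_left has_bochner_integral_sum)

text \<open>The substitution of \<open>t / s\<close> for \<open>t\<close> turns the integral into
  Euler's integral for Gamma.\<close>

lemma has_laplace_powr:
  assumes "0 < \<beta>" "0 < s"
  shows "has_laplace (\<lambda>t. t powr (\<beta> - 1) / Gamma \<beta>) s (s powr (- \<beta>))"
  unfolding has_laplace_def
proof (rule has_bochner_integral_nn_integral)
  have G: "Gamma \<beta> > 0" using assms by simp
  then have G0: "Gamma \<beta> \<noteq> 0" by (rule less_imp_neq[symmetric])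
  have "(\<integral>\<^sup>+t. ennreal (indicator {0<..} t * (exp (- s * t) * (t powr (\<beta> - 1) / Gamma \<beta>))) \<partial>lborel)
    = ennreal (1/s) * (\<integral>\<^sup>+t. ennreal (indicator {0<..} (t/s) * (exp (- t) * ((t/s) powr (\<beta> - 1) / Gamma \<beta>))) \<partial>lborel)"
    using assms by (subst nn_integral_real_affine[where c="1/s" and t=0]) auto
  also have "(\<integral>\<^sup>+t. ennreal (indicator {0<..} (t/s) * (exp (- t) * ((t/s) powr (\<beta> - 1) / Gamma \<beta>))) \<partial>lborel)
    = (\<integral>\<^sup>+t. ennreal (s powr (1 - \<beta>) / Gamma \<beta>) * ennreal (indicator {0..} t * t powr (\<beta> - 1) / exp t) \<partial>lborel)"
    using assms G
    by (intro nn_integral_cong)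
       (auto simp: ennreal_mult[symmetric] powr_divide powr_diff exp_minus field_simps split: split_indicator)
  also have "\<dots> = ennreal (s powr (1 - \<beta>) / Gamma \<beta>) * Gamma \<beta>"
    using assms by (subst nn_integral_cmult) (auto simp: Gamma_conv_nn_integral_real)
  also have "ennreal (1/s) * \<dots> = ennreal (s powr (- \<beta>))"
    using assms G0 by (simp add: ennreal_mult[symmetric] powr_diff powr_minus field_simps)
  finally show "(\<integral>\<^sup>+t. ennreal (indicator {0<..} t * (exp (- s * t) * (t powr (\<beta> - 1) / Gamma \<beta>))) \<partial>lborel)
    = ennreal (s powr (- \<beta>))" .
qed (use assms in \<open>auto split: split_indicator\<close>)

lemma weakly_singularD:
  assumes "weakly_singular \<beta> f" "0 < T"
  obtains C where "0 \<le> C" "\<And>t. 0 < t \<Longrightarrow> t \<le> T \<Longrightarrow> \<bar>f t\<bar> \<le> C * t powr (\<beta> - 1)"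
proof -
  obtain C where C: "\<And>t. 0 < t \<Longrightarrow> t \<le> T \<Longrightarrow> \<bar>f t\<bar> \<le> C * t powr (\<beta> - 1)"
    using assms unfolding weakly_singular_def by blast
  show thesis
  proof (rule that[of "\<bar>C\<bar>"])
    fix t assume "0 < t" "t \<le> T"
    then have "\<bar>f t\<bar> \<le> C * t powr (\<beta> - 1)" by (rule C)
    also have "\<dots> \<le> \<bar>C\<bar> * t powr (\<beta> - 1)" by (intro mult_right_mono) auto
    finally show "\<bar>f t\<bar> \<le> \<bar>C\<bar> * t powr (\<beta> - 1)" .
  qed simp
qed

text \<open>On \<open>(0, T]\<close> the surplus factor \<open>t powr (\<beta> - \<gamma>)\<close>
  is bounded by its value at \<open>T\<close>. This keeps convolution powers, whose exponents grow,
  in one class.\<close>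

lemma weakly_singular_mono:
  assumes "weakly_singular \<beta> f" "\<gamma> \<le> \<beta>"
  shows "weakly_singular \<gamma> f"
  unfolding weakly_singular_def
proof (intro conjI allI impI)
  show "continuous_on {0<..} f" using assms by (simp add: weakly_singular_def)
  fix T :: real assume T: "0 < T"
  obtain C where C: "0 \<le> C" "\<And>t. 0 < t \<Longrightarrow> t \<le> T \<Longrightarrow> \<bar>f t\<bar> \<le> C * t powr (\<beta> - 1)"
    using weakly_singularD[OF assms(1) T] by blast
  show "\<exists>C. \<forall>t. 0 < t \<and> t \<le> T \<longrightarrow> \<bar>f t\<bar> \<le> C * t powr (\<gamma> - 1)"
  proof (intro exI allI impI)
    fix t assume t: "0 < t \<and> t \<le> T"
    have "t powr (\<beta> - 1) = t powr (\<beta> - \<gamma>) * t powr (\<gamma> - 1)"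
      by (simp flip: powr_add)
    also have "\<dots> \<le> T powr (\<beta> - \<gamma>) * t powr (\<gamma> - 1)"
      using t assms by (intro mult_right_mono powr_mono2) auto
    finally have "C * t powr (\<beta> - 1) \<le> C * (T powr (\<beta> - \<gamma>) * t powr (\<gamma> - 1))"
      using C by (intro mult_left_mono)
    then show "\<bar>f t\<bar> \<le> (C * T powr (\<beta> - \<gamma>)) * t powr (\<gamma> - 1)"
      using C(2)[of t] t by (simp add: mult_ac)
  qed
qed

lemma weakly_singular_powr: "weakly_singular \<beta> (\<lambda>t. t powr (\<beta> - 1) / c)"
  unfolding weakly_singular_def
  by (auto intro!: continuous_intros exI[of _ "1 / \<bar>c\<bar>"] simp: divide_inverse mult.commute abs_mult)

text \<open>Scaling moves \<open>t\<close> from the domain of integration into the integrand, so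
  that bounds and continuity in \<open>t\<close> can be obtained by domination on the fixed interval
  \<open>(0, 1)\<close>.\<close>

lemma conv_rescale:
  assumes "0 < t"
  shows "conv f g t = t * (LINT x:{0<..<1}|lborel. f (t * x) * g (t * (1 - x)))"
    and "set_integrable lborel {0<..<t} (\<lambda>x. f x * g (t - x)) \<longleftrightarrow>
      set_integrable lborel {0<..<1} (\<lambda>x. f (t * x) * g (t * (1 - x)))"
proof -
  have ind: "indicator {0<..<t} (t * x) = (indicator {0<..<1} x :: real)" for x
    using assms by (auto simp: zero_less_mult_iff split: split_indicator)
  show "conv f g t = t * (LINT x:{0<..<1}|lborel. f (t * x) * g (t * (1 - x)))"
    using assms unfolding conv_def set_lebesgue_integral_def
    by (subst lborel_integral_real_affine[where c=t and t=0]) (auto simp: ind right_diff_distrib)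
  show "set_integrable lborel {0<..<t} (\<lambda>x. f x * g (t - x)) \<longleftrightarrow>
      set_integrable lborel {0<..<1} (\<lambda>x. f (t * x) * g (t * (1 - x)))"
    using assms unfolding set_integrable_def
    by (subst lborel_integrable_real_affine_iff[where c=t and t=0, symmetric]) (auto simp: ind right_diff_distrib)
qed

text \<open>Euler's Beta integral is available as a gauge integral; nonnegativity of the integrand
  makes it absolutely convergent.\<close>

lemma set_integrable_Beta:
  fixes a b :: real
  assumes "0 < a" "0 < b"
  shows "set_integrable lborel {0<..<1} (\<lambda>t. t powr (a - 1) * (1 - t) powr (b - 1))"
proof -
  have "(\<lambda>t. t powr (a - 1) * (1 - t) powr (b - 1)) integrable_on {0<..<1}"
    using has_integral_Beta_real[OF assms] has_integral_Icc_iff_Ioo by blast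
  then have "(\<lambda>t. t powr (a - 1) * (1 - t) powr (b - 1)) absolutely_integrable_on {0<..<1}"
    by (rule nonnegative_absolutely_integrable_1) auto
  then show ?thesis
    unfolding set_integrable_def
    by (subst (asm) integrable_completion) (auto intro!: borel_measurable_continuous_on_indicator continuous_intros)
qed

text \<open>After rescaling to \<open>(0, 1)\<close> the integrand is at most a multiple of
  \<open>t powr (\<beta> + \<gamma> - 2)\<close> times the Beta integrand, which is integrable and
  free of \<open>t\<close>. The Jacobian \<open>t\<close> supplies the missing power.\<close>

lemma weakly_singular_conv:
  assumes f: "weakly_singular \<beta> f" and g: "weakly_singular \<gamma> g" and pos: "0 < \<beta>" "0 < \<gamma>"
  shows "weakly_singular (\<beta> + \<gamma>) (conv f g)"
    and "\<And>t. 0 < t \<Longrightarrow> set_integrable lborel {0<..<t} (\<lambda>x. f x * g (t - x))"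
proof -
  let ?k = "\<lambda>t x. f (t * x) * g (t * (1 - x))"
  let ?b = "\<lambda>x::real. x powr (\<beta> - 1) * (1 - x) powr (\<gamma> - 1)"
  have meas: "set_borel_measurable lborel {0<..<1} (?k t)" if "0 < t" for t
  proof -
    have "continuous_on {0<..} f" "continuous_on {0<..} g"
      using f g by (auto simp: weakly_singular_def)
    then have "continuous_on {0<..<1} (\<lambda>x. f (t * x))"
      and "continuous_on {0<..<1} (\<lambda>x. g (t * (1 - x)))"
      using that
      by (auto intro!: continuous_on_compose2[of "{0<..}" f "{0<..<1}" "\<lambda>x. t * x"]
          continuous_on_compose2[of "{0<..}" g "{0<..<1}" "\<lambda>x. t * (1 - x)"]
          continuous_on_mult continuous_on_diff continuous_on_const continuous_on_id)
    then have "continuous_on {0<..<1} (?k t)" by (rule continuous_on_mult)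
    then show ?thesis
      using borel_measurable_continuous_on_indicator[of "{0<..<1}" "?k t"] by (simp add: set_borel_measurable_def)
  qed
  have bound: "\<exists>C\<ge>0. \<forall>t x. 0 < t \<longrightarrow> t \<le> T \<longrightarrow> x \<in> {0<..<1} \<longrightarrow> \<bar>?k t x\<bar> \<le> C * t powr (\<beta> + \<gamma> - 2) * ?b x"
    if T: "0 < T" for T
  proof -
    obtain A where A: "0 \<le> A" "\<And>t. 0 < t \<Longrightarrow> t \<le> T \<Longrightarrow> \<bar>f t\<bar> \<le> A * t powr (\<beta> - 1)"
      using weakly_singularD[OF f T] by blast
    obtain B where B: "0 \<le> B" "\<And>t. 0 < t \<Longrightarrow> t \<le> T \<Longrightarrow> \<bar>g t\<bar> \<le> B * t powr (\<gamma> - 1)"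
      using weakly_singularD[OF g T] by blast
    have "\<bar>?k t x\<bar> \<le> (A * B) * t powr (\<beta> + \<gamma> - 2) * ?b x" if "0 < t" "t \<le> T" "x \<in> {0<..<1}" for t x
    proof -
      have *: "t * x \<le> T * 1" "t * (1 - x) \<le> T * 1" using that T by (intro mult_mono; auto)+
      have "\<bar>?k t x\<bar> = \<bar>f (t * x)\<bar> * \<bar>g (t * (1 - x))\<bar>" by (simp add: abs_mult)
      also have "\<dots> \<le> (A * (t * x) powr (\<beta> - 1)) * (B * (t * (1 - x)) powr (\<gamma> - 1))"
        using that * A(1) by (intro mult_mono A(2) B(2)) auto
      also have "\<dots> = (A * B) * (t powr (\<beta> - 1) * t powr (\<gamma> - 1)) * ?b x"
        using that by (simp add: powr_mult mult_ac)
      also have "t powr (\<beta> - 1) * t powr (\<gamma> - 1) = t powr (\<beta> + \<gamma> - 2)"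
        by (simp flip: powr_add add: algebra_simps)
      finally show ?thesis .
    qed
    then show ?thesis using A(1) B(1) by (intro exI[of _ "A * B"]) auto
  qed
  have int: "set_integrable lborel {0<..<1} (?k t)" if t: "0 < t" for t
  proof -
    obtain C where C: "0 \<le> C" "\<And>x. x \<in> {0<..<1} \<Longrightarrow> \<bar>?k t x\<bar> \<le> C * t powr (\<beta> + \<gamma> - 2) * ?b x"
      using bound[OF t] t by blast
    show ?thesis
    proof (rule set_integrable_bound[of _ _ "\<lambda>x. C * t powr (\<beta> + \<gamma> - 2) * ?b x"])
      show "set_integrable lborel {0<..<1} (\<lambda>x. C * t powr (\<beta> + \<gamma> - 2) * ?b x)"
        using set_integrable_Beta[OF pos] by (rule set_integrable_mult_right)
      show "AE x in lborel. x \<in> {0<..<1} \<longrightarrow> norm (?k t x) \<le> norm (C * t powr (\<beta> + \<gamma> - 2) * ?b x)"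
        using order_trans[OF C(2) abs_ge_self] by (simp only: real_norm_def) blast
    qed (use meas[OF t] in auto)
  qed
  then show "\<And>t. 0 < t \<Longrightarrow> set_integrable lborel {0<..<t} (\<lambda>x. f x * g (t - x))"
    by (simp add: conv_rescale)
  show "weakly_singular (\<beta> + \<gamma>) (conv f g)"
    unfolding weakly_singular_def
  proof (intro conjI allI impI)
    have "continuous_on {0<..} (\<lambda>t. t * (LINT x:{0<..<1}|lborel. ?k t x))"
    proof (intro continuous_intros, unfold continuous_on_sequentially, intro allI ballI impI, elim conjE)
      fix X :: "nat \<Rightarrow> real" and t :: real
      assume t: "t \<in> {0<..}" and X: "\<forall>n. X n \<in> {0<..}" "X \<longlonglongrightarrow> t"
      obtain T where T: "0 < T" "\<And>n. X n \<le> T"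
      proof -
        have "Bseq X" using X(2) convergent_imp_Bseq convergent_def by blast
        then obtain K where "0 < K" "\<And>n. norm (X n) \<le> K" by (auto elim: BseqE)
        then show thesis by (intro that[of K]) (auto simp: abs_le_iff)
      qed
      \<comment> \<open>The exponent may be negative; the powers stay bounded along the sequence
        because its limit \<open>t\<close> is positive.\<close>
      have "(\<lambda>n. X n powr (\<beta> + \<gamma> - 2)) \<longlonglongrightarrow> t powr (\<beta> + \<gamma> - 2)"
        using t X by (intro tendsto_intros) auto
      then have "Bseq (\<lambda>n. X n powr (\<beta> + \<gamma> - 2))"
        using convergent_imp_Bseq convergent_def by blast
      then obtain K where K: "0 < K" "\<And>n. X n powr (\<beta> + \<gamma> - 2) \<le> K" by (auto elim: BseqE)
      obtain C where C: "0 \<le> C"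
        "\<And>t x. 0 < t \<Longrightarrow> t \<le> T \<Longrightarrow> x \<in> {0<..<1} \<Longrightarrow> \<bar>?k t x\<bar> \<le> C * t powr (\<beta> + \<gamma> - 2) * ?b x"
        using bound[OF T(1)] by blast
      show "((\<lambda>t. LINT x:{0<..<1}|lborel. ?k t x) \<circ> X) \<longlonglongrightarrow> (LINT x:{0<..<1}|lborel. ?k t x)"
        unfolding set_lebesgue_integral_def comp_def
      proof (rule integral_dominated_convergence)
        show "integrable lborel (\<lambda>x. indicator {0<..<1} x *\<^sub>R (C * K * ?b x))"
          unfolding set_integrable_def[symmetric]
          using set_integrable_Beta[OF pos] by (rule set_integrable_mult_right)
        show "AE x in lborel. (\<lambda>n. indicator {0<..<1} x *\<^sub>R ?k (X n) x) \<longlonglongrightarrow> indicator {0<..<1} x *\<^sub>R ?k t x"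
        proof (intro AE_I2)
          fix x :: real
          show "(\<lambda>n. indicator {0<..<1} x *\<^sub>R ?k (X n) x) \<longlonglongrightarrow> indicator {0<..<1} x *\<^sub>R ?k t x"
          proof (cases "x \<in> {0<..<1}")
            case True
            have cf: "isCont f (t * x)" "isCont g (t * (1 - x))"
              using f g t True by (auto simp: weakly_singular_def continuous_on_eq_continuous_at)
            have lim: "(\<lambda>n. X n * x) \<longlonglongrightarrow> t * x" "(\<lambda>n. X n * (1 - x)) \<longlonglongrightarrow> t * (1 - x)"
              by (intro tendsto_intros X(2))+
            then show ?thesis
              using True tendsto_mult[OF isCont_tendsto_compose[OF cf(1) lim(1)]
                  isCont_tendsto_compose[OF cf(2) lim(2)]] by simp
          qed simp
        qed
        fix n
        have Xn: "0 < X n" using X(1) by auto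
        show "AE x in lborel. norm (indicator {0<..<1} x *\<^sub>R ?k (X n) x) \<le> indicator {0<..<1} x *\<^sub>R (C * K * ?b x)"
        proof (intro AE_I2)
          fix x :: real
          show "norm (indicator {0<..<1} x *\<^sub>R ?k (X n) x) \<le> indicator {0<..<1} x *\<^sub>R (C * K * ?b x)"
          proof (cases "x \<in> {0<..<1}")
            case True
            have "\<bar>?k (X n) x\<bar> \<le> C * X n powr (\<beta> + \<gamma> - 2) * ?b x"
              using Xn T True by (intro C) auto
            also have "\<dots> \<le> C * K * ?b x"
              using K C(1) by (intro mult_right_mono mult_left_mono) auto
            finally show ?thesis using True by simp
          qed simp
        qed
        show "(\<lambda>x. indicator {0<..<1} x *\<^sub>R ?k (X n) x) \<in> borel_measurable lborel"
          using meas[OF Xn] by (simp add: set_borel_measurable_def)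
      qed (use meas[of t] t in \<open>auto simp: set_borel_measurable_def\<close>)
    qed
    then show "continuous_on {0<..} (conv f g)"
      by (rule continuous_on_eq) (simp add: conv_rescale)
  next
    fix T :: real assume T: "0 < T"
    obtain C where C: "0 \<le> C"
        "\<And>t x. 0 < t \<Longrightarrow> t \<le> T \<Longrightarrow> x \<in> {0<..<1} \<Longrightarrow> \<bar>?k t x\<bar> \<le> C * t powr (\<beta> + \<gamma> - 2) * ?b x"
        using bound[OF T(1)] by blast
    let ?B = "LINT x:{0<..<1}|lborel. ?b x"
    show "\<exists>C. \<forall>t. 0 < t \<and> t \<le> T \<longrightarrow> \<bar>conv f g t\<bar> \<le> C * t powr (\<beta> + \<gamma> - 1)"
    proof (intro exI allI impI)
      fix t assume t: "0 < t \<and> t \<le> T"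
      have "\<bar>LINT x:{0<..<1}|lborel. ?k t x\<bar> \<le> (LINT x:{0<..<1}|lborel. norm (?k t x))"
        using set_integral_norm_bound[OF int, of t] t by simp
      also have "\<dots> \<le> (LINT x:{0<..<1}|lborel. C * t powr (\<beta> + \<gamma> - 2) * ?b x)"
      proof (rule set_integral_mono)
        show "set_integrable lborel {0<..<1} (\<lambda>x. norm (?k t x))"
          using int t by (intro set_integrable_norm) auto
        show "set_integrable lborel {0<..<1} (\<lambda>x. C * t powr (\<beta> + \<gamma> - 2) * ?b x)"
          using set_integrable_Beta[OF pos] by (rule set_integrable_mult_right)
      qed (use C(2) t in auto)
      also have "\<dots> = C * t powr (\<beta> + \<gamma> - 2) * ?B"
        by simp
      finally have le: "t * \<bar>LINT x:{0<..<1}|lborel. ?k t x\<bar> \<le> t * (C * t powr (\<beta> + \<gamma> - 2) * ?B)"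
        using t by (intro mult_left_mono) auto
      have "\<bar>conv f g t\<bar> = t * \<bar>LINT x:{0<..<1}|lborel. ?k t x\<bar>"
        using t by (simp add: conv_rescale abs_mult)
      also note le
      also have "t * (C * t powr (\<beta> + \<gamma> - 2) * ?B) = C * ?B * (t * t powr (\<beta> + \<gamma> - 2))"
        by (simp only: mult_ac)
      also have "t * t powr (\<beta> + \<gamma> - 2) = t powr (\<beta> + \<gamma> - 1)"
        using t powr_mult_base[of t "\<beta> + \<gamma> - 2"] by (simp add: algebra_simps)
      finally show "\<bar>conv f g t\<bar> \<le> (C * ?B) * t powr (\<beta> + \<gamma> - 1)" .
    qed
  qed
qed

text \<open>The weight \<open>exp (- s * t)\<close> splits as a product over \<open>x\<close> and
  \<open>t - x\<close>. With both weighted factors extended by 0 to the whole line, Fubini and the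
  translation invariance of Lebesgue measure give the product.\<close>

lemma has_laplace_conv:
  assumes "has_laplace f s F" "has_laplace g s G"
  shows "has_laplace (conv f g) s (F * G)"
proof -
  define f0 where "f0 = (\<lambda>t. indicator {0<..} t * (exp (- s * t) * f t))"
  define g0 where "g0 = (\<lambda>t. indicator {0<..} t * (exp (- s * t) * g t))"
  have f0: "integrable lborel f0" "integral\<^sup>L lborel f0 = F"
    and g0: "integrable lborel g0" "integral\<^sup>L lborel g0 = G"
    using assms by (auto simp: has_laplace_def f0_def g0_def has_bochner_integral_iff)
  have [measurable]: "f0 \<in> borel_measurable borel" "g0 \<in> borel_measurable borel"
    using f0 g0 by auto
  have shift: "integrable lborel (\<lambda>t. g0 (t - x))" "(LINT t|lborel. g0 (t - x)) = G"
     "(LINT t|lborel. \<bar>g0 (t - x)\<bar>) = (LINT t|lborel. \<bar>g0 t\<bar>)" for x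
    using g0 lborel_integrable_real_affine[of g0 1 "- x"] lborel_integral_real_affine[of 1 g0 "- x"]
      lborel_integral_real_affine[of 1 "\<lambda>t. \<bar>g0 t\<bar>" "- x"] by simp_all
  have int: "integrable (lborel \<Otimes>\<^sub>M lborel) (\<lambda>(x, t). f0 x * g0 (t - x))"
  proof (rule lborel_pair.Fubini_integrable)
    show "integrable lborel (\<lambda>x. LINT y|lborel. norm (case (x, y) of (x, t) \<Rightarrow> f0 x * g0 (t - x)))"
      using f0 by (simp add: abs_mult shift integrable_abs)
  qed (use shift in auto)
  have "f0 x * g0 (t - x) =
    (indicator {0<..} t * exp (- s * t)) * (indicator {0<..<t} x *\<^sub>R (f x * g (t - x)))" for x t
  proof -
    have "exp (- s * t) = exp (- s * x) * exp (- s * (t - x))"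
      by (simp add: algebra_simps flip: exp_add)
    then show ?thesis by (auto simp: f0_def g0_def split: split_indicator)
  qed
  then have eq: "(LINT x|lborel. f0 x * g0 (t - x)) = indicator {0<..} t * (exp (- s * t) * conv f g t)" for t
    unfolding conv_def set_lebesgue_integral_def by (simp only: integral_mult_right_zero mult.assoc)
  have "(LINT t|lborel. (LINT x|lborel. f0 x * g0 (t - x))) = (LINT x|lborel. (LINT t|lborel. f0 x * g0 (t - x)))"
    by (rule lborel_pair.Fubini_integral[OF int])
  also have "\<dots> = F * G" using f0 by (simp add: shift)
  finally have "(LINT t|lborel. indicator {0<..} t * (exp (- s * t) * conv f g t)) = F * G"
    by (simp add: eq)
  moreover have "integrable lborel (\<lambda>t. indicator {0<..} t * (exp (- s * t) * conv f g t))"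
    using lborel_pair.integrable_snd[OF int] by (simp add: eq)
  ultimately show ?thesis
    by (simp add: has_laplace_def has_bochner_integral_iff)
qed

lemma has_laplace_cong:
  assumes "\<And>t. 0 < t \<Longrightarrow> f t = g t"
  shows "has_laplace f s F \<longleftrightarrow> has_laplace g s F"
proof -
  have "(\<lambda>t. indicator {0<..} t * (exp (- s * t) * f t)) = (\<lambda>t. indicator {0<..} t * (exp (- s * t) * g t))"
    using assms by (auto split: split_indicator)
  then show ?thesis by (simp add: has_laplace_def)
qed

lemma has_laplace_one: "0 < s \<Longrightarrow> has_laplace (\<lambda>_. 1) s (1 / s)"
  using has_laplace_powr[of 1 s]
  by (subst has_laplace_cong[of _ "\<lambda>t. t powr (1 - 1) / Gamma 1"]) (auto simp: powr_minus_divide)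

lemma weakly_singular_one: "weakly_singular 1 (\<lambda>_. 1)"
  unfolding weakly_singular_def by (auto intro!: exI[of _ 1])

lemma weakly_singular_diff:
  assumes f: "weakly_singular \<beta> f" and g: "weakly_singular \<beta> g"
  shows "weakly_singular \<beta> (\<lambda>t. f t - g t)"
  unfolding weakly_singular_def
proof (intro conjI allI impI)
  show "continuous_on {0<..} (\<lambda>t. f t - g t)"
    using f g by (intro continuous_on_diff) (auto simp: weakly_singular_def)
  fix T :: real assume T: "0 < T"
  obtain A where A: "\<And>t. 0 < t \<Longrightarrow> t \<le> T \<Longrightarrow> \<bar>f t\<bar> \<le> A * t powr (\<beta> - 1)"
    using weakly_singularD[OF f T] by blast
  obtain B where B: "\<And>t. 0 < t \<Longrightarrow> t \<le> T \<Longrightarrow> \<bar>g t\<bar> \<le> B * t powr (\<beta> - 1)"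
    using weakly_singularD[OF g T] by blast
  show "\<exists>C. \<forall>t. 0 < t \<and> t \<le> T \<longrightarrow> \<bar>f t - g t\<bar> \<le> C * t powr (\<beta> - 1)"
  proof (intro exI allI impI)
    fix t assume t: "0 < t \<and> t \<le> T"
    have "\<bar>f t - g t\<bar> \<le> \<bar>f t\<bar> + \<bar>g t\<bar>" by (rule abs_triangle_ineq4)
    also have "\<dots> \<le> (A + B) * t powr (\<beta> - 1)"
      using A[of t] B[of t] t by (simp add: distrib_right)
    finally show "\<bar>f t - g t\<bar> \<le> (A + B) * t powr (\<beta> - 1)" .
  qed
qed

section \<open>Primitives, and the Caputo derivative as a convolution\<close>

lemma weakly_singular_continuous_at:
  "weakly_singular \<beta> f \<Longrightarrow> 0 < t \<Longrightarrow> isCont f t"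
  by (auto simp: weakly_singular_def continuous_on_eq_continuous_at)

text \<open>Convolution with the constant 1 is integration from 0. The possible singularity at 0 is
  confined to the integral over \<open>(0, a)\<close>, which is a constant, and the fundamental
  theorem of calculus applies on \<open>[a, b]\<close>, where \<open>f\<close> is
  continuous.\<close>

lemma weakly_singular_conv_one_has_derivative:
  assumes f: "weakly_singular \<beta> f" and pos: "0 < \<beta>" "0 < t"
  shows "(conv f (\<lambda>_. 1) has_real_derivative f t) (at t)"
proof -
  define a where "a = t / 2"
  define b where "b = 2 * t"
  have ab: "0 < a" "a < t" "t < b" using pos by (auto simp: a_def b_def)
  have int: "set_integrable lborel {0<..<x} f" if "0 < x" for x
    using weakly_singular_conv(2)[OF f weakly_singular_one _ _ that] pos by simp
  have cont: "continuous_on {a..b} f"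
    using f ab by (auto simp: weakly_singular_def intro: continuous_on_subset)
  have "((\<lambda>x. integral {a..x} f) has_real_derivative f t) (at t within {a..b})"
    using ab by (intro integral_has_real_derivative cont) auto
  then have "((\<lambda>x. conv f (\<lambda>_. 1) a + integral {a..x} f) has_real_derivative f t) (at t)"
    using ab by (auto simp: at_within_Icc_at intro!: derivative_eq_intros)
  then show ?thesis
  proof (rule has_field_derivative_transform_within_open)
    show "open {a<..<b}" "t \<in> {a<..<b}" using ab by auto
    fix x assume x: "x \<in> {a<..<b}"
    have "set_integrable lborel {a..<x} f"
      by (rule set_integrable_subset[OF int[of x]]) (use x ab in auto)
    then have "(LINT y:{0<..<a} \<union> {a..<x}|lborel. f y) = (LINT y:{0<..<a}|lborel. f y) + (LINT y:{a..<x}|lborel. f y)"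
      using ab int[of a] by (intro set_integral_Un) auto
    moreover have "{0<..<a} \<union> {a..<x} = {0<..<x}" using x ab by auto
    moreover have "(LINT y:{a..<x}|lborel. f y) = integral {a..<x} f"
      by (rule set_borel_integral_eq_integral) fact
    moreover have "integral {a..<x} f = integral {a..x} f"
    proof (rule integral_spike_set)
      have "{y \<in> {a..<x} - {a..x}. f y \<noteq> 0} \<subseteq> {x}" "{y \<in> {a..x} - {a..<x}. f y \<noteq> 0} \<subseteq> {x}" by auto
      then show "negligible {y \<in> {a..<x} - {a..x}. f y \<noteq> 0}" "negligible {y \<in> {a..x} - {a..<x}. f y \<noteq> 0}"
        using negligible_sing negligible_subset by blast+
    qed
    ultimately show "conv f (\<lambda>_. 1) a + integral {a..x} f = conv f (\<lambda>_. 1) x"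
      by (simp add: conv_def)
  qed
qed

text \<open>This is \<open>t powr (- \<alpha>) / Gamma (1 - \<alpha>)\<close>; the unsimplified
  exponent matches \<open>weakly_singular_powr\<close> and \<open>has_laplace_powr\<close> at
  exponent \<open>1 - \<alpha>\<close>.\<close>

definition caputo_kernel :: "real \<Rightarrow> real \<Rightarrow> real" where
  "caputo_kernel \<alpha> t = t powr ((1 - \<alpha>) - 1) / Gamma (1 - \<alpha>)"

lemma weakly_singular_caputo_kernel: "weakly_singular (1 - \<alpha>) (caputo_kernel \<alpha>)"
  unfolding caputo_kernel_def[abs_def] by (rule weakly_singular_powr)

lemma has_laplace_caputo_kernel:
  assumes "\<alpha> < 1" "0 < s"
  shows "has_laplace (caputo_kernel \<alpha>) s (s powr \<alpha> / s)"
proof -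
  have "s powr (- (1 - \<alpha>)) = s powr \<alpha> / s" using assms by (simp add: powr_diff)
  then show ?thesis
    using has_laplace_powr[of "1 - \<alpha>" s] assms by (simp add: caputo_kernel_def[abs_def])
qed

text \<open>On the open interval \<open>deriv u\<close> coincides with \<open>F\<close>, which may
  be unbounded near 0. Absolute convergence holds because \<open>F\<close> and the kernel are weakly
  singular with the positive exponents \<beta> and \<open>1 - \<alpha>\<close>.\<close>

lemma caputo_eq_conv:
  assumes F: "weakly_singular \<beta> F" "0 < \<beta>" and \<alpha>: "\<alpha> < 1" and t: "0 < t"
    and u: "\<And>\<tau>. 0 < \<tau> \<Longrightarrow> (u has_real_derivative F \<tau>) (at \<tau>)"
  shows "set_integrable lborel {0<..<t} (\<lambda>\<tau>. deriv u \<tau> / (t - \<tau>) powr \<alpha>)"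
    and "caputo \<alpha> u t = conv F (caputo_kernel \<alpha>) t"
proof -
  have eq: "deriv u \<tau> / (t - \<tau>) powr \<alpha> = Gamma (1 - \<alpha>) * (F \<tau> * caputo_kernel \<alpha> (t - \<tau>))"
    if "\<tau> \<in> {0<..<t}" for \<tau>
  proof -
    have "Gamma (1 - \<alpha>) > 0" using \<alpha> by (intro Gamma_real_pos) simp
    then show ?thesis
      using DERIV_imp_deriv[OF u, of \<tau>] that
      by (simp add: caputo_kernel_def powr_minus_divide)
  qed
  have "set_integrable lborel {0<..<t} (\<lambda>x. F x * caputo_kernel \<alpha> (t - x))"
    by (rule weakly_singular_conv(2)[OF F(1) _ F(2) _ t, of "1 - \<alpha>"])
       (use \<alpha> in \<open>auto intro: weakly_singular_caputo_kernel\<close>)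
  then have "set_integrable lborel {0<..<t} (\<lambda>\<tau>. Gamma (1 - \<alpha>) * (F \<tau> * caputo_kernel \<alpha> (t - \<tau>)))"
    by (rule set_integrable_mult_right)
  then show "set_integrable lborel {0<..<t} (\<lambda>\<tau>. deriv u \<tau> / (t - \<tau>) powr \<alpha>)"
    by (subst set_integrable_cong[OF refl refl eq])
  have "(LINT \<tau>:{0<..<t}|lborel. deriv u \<tau> / (t - \<tau>) powr \<alpha>) =
      (LINT \<tau>:{0<..<t}|lborel. Gamma (1 - \<alpha>) * (F \<tau> * caputo_kernel \<alpha> (t - \<tau>)))"
    by (intro set_lebesgue_integral_cong allI impI eq) auto
  also have "\<dots> = Gamma (1 - \<alpha>) * conv F (caputo_kernel \<alpha>) t"
    unfolding conv_def by (rule set_integral_mult_right)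
  finally show "caputo \<alpha> u t = conv F (caputo_kernel \<alpha>) t"
    using less_imp_neq[OF Gamma_real_pos[of "1 - \<alpha>"]] \<alpha> by (simp add: caputo_def)
qed

section \<open>Uniqueness of the Laplace transform\<close>

text \<open>The positive and negative parts of \<open>exp (- s0 * t) * f t\<close>, pushed forward by \<open>t \<mapsto> exp (- t)\<close>,
  are measures on \<open>[0, 1]\<close> with the same moments, hence with the same characteristic function.\<close>

lemma has_laplace_zero_imp_AE_zero:
  assumes "\<And>s. s0 \<le> s \<Longrightarrow> has_laplace f s 0"
  shows "AE t in lborel. 0 < t \<longrightarrow> f t = 0"
proof -
  define g where "g = (\<lambda>t. indicator {0<..} t * (exp (- s0 * t) * f t))"
  have g: "integrable lborel g"
    using assms[of s0] by (simp add: has_laplace_def g_def has_bochner_integral_iff)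
  then have [measurable]: "g \<in> borel_measurable borel" by auto
  \<comment> \<open>The moment of order \<open>n\<close> in the variable \<open>exp (- t)\<close> is
    the transform at \<open>s0 + n\<close>.\<close>
  have mom: "(LINT t|lborel. exp (- t) ^ n * g t) = 0" for n :: nat
  proof -
    have "exp (- t) ^ n * g t = indicator {0<..} t * (exp (- (s0 + n) * t) * f t)" for t
    proof -
      have "exp (- (s0 + n) * t) = exp (- t) ^ n * exp (- s0 * t)"
        by (simp add: algebra_simps flip: exp_add exp_of_nat_mult)
      then show ?thesis by (simp add: g_def)
    qed
    then show ?thesis
      using assms[of "s0 + n"] by (simp add: has_laplace_def has_bochner_integral_iff)
  qed
  define P where "P = (\<lambda>t. max 0 (g t))"
  define Q where "Q = (\<lambda>t. max 0 (- g t))"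
  have PQ: "g t = P t - Q t" "0 \<le> P t" "0 \<le> Q t" for t
    by (auto simp: P_def Q_def)
  have int: "integrable lborel P" "integrable lborel Q"
    using g by (auto simp: P_def Q_def)
  then have [measurable]: "P \<in> borel_measurable borel" "Q \<in> borel_measurable borel" by auto
  \<comment> \<open>The moment of order 0 gives \<open>P\<close> and \<open>Q\<close> the same mass
    \<open>c\<close>. Unless it is 0, dividing by it makes both into probability densities, to which
    uniqueness of characteristic functions applies.\<close>
  define c where "c = (LINT t|lborel. P t)"
  have "(LINT t|lborel. g t) = c - (LINT t|lborel. Q t)"
    unfolding PQ(1) c_def using int by simp
  then have c: "(LINT t|lborel. P t) = c" "(LINT t|lborel. Q t) = c"
    using mom[of 0] by (simp_all add: c_def)
  have "AE t in lborel. P t = Q t"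
  proof (cases "c = 0")
    case True
    then have "AE t in lborel. P t = 0" "AE t in lborel. Q t = 0"
      using c int PQ by (simp_all add: integral_nonneg_eq_0_iff_AE)
    then show ?thesis by eventually_elim simp
  next
    case False
    have "0 \<le> c" unfolding c_def using PQ by simp
    with False have "0 < c" by simp
    define \<mu> where "\<mu> = (\<lambda>R :: real \<Rightarrow> real. density lborel (\<lambda>t. ennreal (R t / c)))"
    have E: "(\<lambda>t::real. exp (- t)) \<in> borel_measurable borel" by measurable
    have \<mu>: "prob_space (\<mu> R)" "char (distr (\<mu> R) borel (\<lambda>t. exp (- t))) \<xi> =
        (CLINT t|lborel. (R t / c) *\<^sub>R iexp (\<xi> * exp (- t)))"
      if "R = P \<or> R = Q" for R \<xi>
    proof -
      have R: "integrable lborel R" "\<And>t. 0 \<le> R t" "(LINT t|lborel. R t) = c"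
        using that int PQ c by auto
      then have [measurable]: "R \<in> borel_measurable borel" by auto
      have "(\<integral>\<^sup>+t. ennreal (R t / c) \<partial>lborel) = ennreal (LINT t|lborel. R t / c)"
        using R \<open>0 < c\<close> by (intro nn_integral_eq_integral) auto
      then show "prob_space (\<mu> R)"
        using R \<open>0 < c\<close> by (intro prob_spaceI) (simp add: \<mu>_def emeasure_density)
      show "char (distr (\<mu> R) borel (\<lambda>t. exp (- t))) \<xi> =
        (CLINT t|lborel. (R t / c) *\<^sub>R iexp (\<xi> * exp (- t)))"
        unfolding char_def \<mu>_def using R \<open>0 < c\<close>
        by (subst integral_distr, simp, simp, subst integral_density) auto
    qed
    have "char (distr (\<mu> P) borel (\<lambda>t. exp (- t))) = char (distr (\<mu> Q) borel (\<lambda>t. exp (- t)))"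
    proof
      fix \<xi> :: real
      \<comment> \<open>\<open>h n\<close> is the \<open>n\<close>-th term of the exponential series
        for the characteristic function, weighted by \<open>g\<close>; its integral is a multiple of
        a vanishing moment.\<close>
      define h where "h = (\<lambda>n t. complex_of_real (g t) * ((\<i> * of_real (\<xi> * exp (- t))) ^ n /\<^sub>R fact n))"
      have h_eq: "h n t = ((\<i> * of_real \<xi>) ^ n /\<^sub>R fact n) * of_real (exp (- t) ^ n * g t)" for n t
        by (simp add: h_def power_mult_distrib scaleR_conv_of_real)
      have norm_h: "norm (h n t) = (\<bar>\<xi>\<bar> ^ n /\<^sub>R fact n) * (exp (- t) ^ n * \<bar>g t\<bar>)" for n t
        unfolding h_eq by (simp add: norm_mult norm_power abs_mult)
      \<comment> \<open>\<open>exp (- t)\<close> is at most 1 for \<open>t > 0\<close>, and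
        \<open>g\<close> vanishes elsewhere; the resulting majorant permits integration term by
        term.\<close>
      have h_le: "norm (h n t) \<le> (\<bar>\<xi>\<bar> ^ n /\<^sub>R fact n) * \<bar>g t\<bar>" for n t
      proof (cases "0 < t")
        case True
        then have "exp (- t) ^ n * \<bar>g t\<bar> \<le> 1 * \<bar>g t\<bar>"
          by (intro mult_right_mono power_le_one) auto
        then show ?thesis unfolding norm_h by (intro mult_left_mono) auto
      qed (simp add: h_def g_def)
      have moment_int: "integrable lborel (\<lambda>t. exp (- t) ^ n * g t)" for n :: nat
      proof (rule Bochner_Integration.integrable_bound[OF g])
        show "AE t in lborel. norm (exp (- t) ^ n * g t) \<le> norm (g t)"
        proof (rule AE_I2)
          fix t :: real
          show "norm (exp (- t) ^ n * g t) \<le> norm (g t)"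
            by (cases "0 < t") (auto simp: g_def abs_mult intro!: mult_left_le_one_le power_le_one)
        qed
      qed simp
      have h_int: "integrable lborel (h n)" "(CLINT t|lborel. h n t) = 0" for n
      proof -
        have "integrable lborel (\<lambda>t. complex_of_real (exp (- t) ^ n * g t))"
          "(CLINT t|lborel. complex_of_real (exp (- t) ^ n * g t)) = 0"
          using moment_int[of n] mom[of n]
          by (simp_all only: integral_complex_of_real complex_of_real_integrable_eq of_real_0)
        then show "integrable lborel (h n)" "(CLINT t|lborel. h n t) = 0"
          unfolding h_eq by (simp_all only: integrable_mult_right integral_mult_right_zero mult_zero_right simp_thms)
      qed
      have sum_exp: "summable (\<lambda>n. \<bar>\<xi>\<bar> ^ n /\<^sub>R fact n)"
        using summable_exp_generic[of "\<bar>\<xi>\<bar>"] .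
      have "(CLINT t|lborel. (\<Sum>n. h n t)) = (\<Sum>n. (CLINT t|lborel. h n t))"
      proof (rule integral_suminf)
        show "integrable lborel (h n)" for n by (rule h_int)
        show "AE t in lborel. summable (\<lambda>n. norm (h n t))"
        proof (rule AE_I2)
          fix t :: real
          show "summable (\<lambda>n. norm (h n t))"
            by (rule summable_comparison_test'[OF summable_mult2[OF sum_exp]]) (use h_le in simp)
        qed
        show "summable (\<lambda>n. LINT t|lborel. norm (h n t))"
        proof (rule summable_comparison_test')
          show "summable (\<lambda>n. (\<bar>\<xi>\<bar> ^ n /\<^sub>R fact n) * (LINT t|lborel. \<bar>g t\<bar>))"
            by (rule summable_mult2[OF sum_exp])
          fix n :: nat
          have "(LINT t|lborel. norm (h n t)) \<le> (LINT t|lborel. (\<bar>\<xi>\<bar> ^ n /\<^sub>R fact n) * \<bar>g t\<bar>)"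
            using h_int g h_le by (intro integral_mono integrable_norm integrable_mult_right integrable_abs)
          then show "norm (LINT t|lborel. norm (h n t)) \<le> (\<bar>\<xi>\<bar> ^ n /\<^sub>R fact n) * (LINT t|lborel. \<bar>g t\<bar>)"
            by simp
        qed
      qed
      also have "\<dots> = 0" by (simp add: h_int)
      finally have "(CLINT t|lborel. (\<Sum>n. h n t)) = 0" .
      moreover have "(\<Sum>n. h n t) = g t *\<^sub>R iexp (\<xi> * exp (- t))" for t
      proof -
        have exp_eq: "exp z = (\<Sum>n. z ^ n /\<^sub>R fact n)" for z :: complex by (simp add: exp_def)
        have "(\<Sum>n. h n t) = complex_of_real (g t) * iexp (\<xi> * exp (- t))"
          unfolding h_def exp_eq[of "\<i> * _"] by (rule suminf_mult[OF summable_exp_generic])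
        then show ?thesis by (simp only: scaleR_conv_of_real)
      qed
      ultimately have zero: "(CLINT t|lborel. g t *\<^sub>R iexp (\<xi> * exp (- t))) = 0" by (simp only:)
      have bdd: "integrable lborel (\<lambda>t. (R t / c) *\<^sub>R iexp (\<xi> * exp (- t)))" if "R = P \<or> R = Q" for R
      proof -
        have R: "integrable lborel (\<lambda>t. R t / c)" using that int by auto
        then have [measurable]: "R \<in> borel_measurable borel" using that by auto
        show ?thesis
          by (rule Bochner_Integration.integrable_bound[OF R]) auto
      qed
      have "(CLINT t|lborel. (P t / c) *\<^sub>R iexp (\<xi> * exp (- t))) - (CLINT t|lborel. (Q t / c) *\<^sub>R iexp (\<xi> * exp (- t)))
        = (CLINT t|lborel. (P t / c) *\<^sub>R iexp (\<xi> * exp (- t)) - (Q t / c) *\<^sub>R iexp (\<xi> * exp (- t)))"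
        by (rule Bochner_Integration.integral_diff[OF bdd bdd, symmetric]) simp_all
      also have "\<dots> = (CLINT t|lborel. (1/c) *\<^sub>R (g t *\<^sub>R iexp (\<xi> * exp (- t))))"
        by (simp only: scaleR_diff_left[symmetric] scaleR_scaleR PQ(1) diff_divide_distrib[symmetric]
            times_divide_eq_left mult_1)
      also have "\<dots> = 0" unfolding integral_scaleR_right zero by simp
      finally show "char (distr (\<mu> P) borel (\<lambda>t. exp (- t))) \<xi> = char (distr (\<mu> Q) borel (\<lambda>t. exp (- t))) \<xi>"
        by (simp add: \<mu>)
    qed
    moreover have "real_distribution (distr (\<mu> R) borel (\<lambda>t. exp (- t)))" if "R = P \<or> R = Q" for R
      using \<mu>(1)[OF that] by (intro prob_space.real_distribution_distr) (auto simp: \<mu>_def)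
    ultimately have eq: "distr (\<mu> P) borel (\<lambda>t. exp (- t)) = distr (\<mu> Q) borel (\<lambda>t. exp (- t))"
      by (intro Levy_uniqueness) auto
    \<comment> \<open>The map \<open>exp (- t)\<close> has the Borel left inverse
      \<open>- ln x\<close>, so equality of the image measures passes back to the measures
      themselves.\<close>
    have undo: "distr (distr (\<mu> R) borel (\<lambda>t. exp (- t))) borel (\<lambda>x. - ln x) = \<mu> R" for R
      by (subst distr_distr) (auto simp: \<mu>_def comp_def intro!: distr_id2)
    have "\<mu> P = \<mu> Q"
      using arg_cong[OF eq, of "\<lambda>m. distr m borel (\<lambda>x. - ln x)"] by (simp only: undo)
    then have "AE t in lborel. ennreal (P t / c) = ennreal (Q t / c)"
      unfolding \<mu>_def by (subst (asm) sigma_finite_measure.density_unique_iff[OF sigma_finite_lborel]) auto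
    then show ?thesis
      by eventually_elim (use \<open>0 < c\<close> PQ(2,3) in \<open>simp add: divide_simps\<close>)
  qed
  then show ?thesis
  proof eventually_elim
    case (elim t)
    then have "g t = 0" by (simp add: PQ(1))
    then show ?case by (auto simp: g_def)
  qed
qed

text \<open>Every interval to the right of \<open>t\<close> has positive length, so it meets the set
  of full measure on which \<open>f\<close> vanishes. Zeros of \<open>f\<close> thus accumulate at
  \<open>t\<close> from the right, also when \<open>t = a\<close>.\<close>

lemma AE_zero_right_continuous:
  fixes f :: "real \<Rightarrow> real"
  assumes AE: "AE t in lborel. a < t \<longrightarrow> f t = 0"
    and cont: "continuous (at_right t) f" and "a \<le> t"
  shows "f t = 0"
proof -
  have "\<exists>x. t < x \<and> x < t + 1 / Suc n \<and> f x = 0" for n :: nat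
  proof (rule ccontr)
    assume "\<nexists>x. t < x \<and> x < t + 1 / Suc n \<and> f x = 0"
    then have "AE x in lborel. x \<notin> {t<..<t + 1 / Suc n}"
      using AE \<open>a \<le> t\<close> by (auto elim!: eventually_mono)
    then have "{t<..<t + 1 / Suc n} \<in> null_sets lborel"
      by (subst AE_iff_null_sets) auto
    moreover have "emeasure lborel {t<..<t + 1 / Suc n} = ennreal (1 / Suc n)" by simp
    ultimately show False by (simp add: null_sets_def del: emeasure_lborel_Ioo of_nat_Suc)
  qed
  then obtain x where x: "\<And>n::nat. t < x n" "\<And>n. x n < t + 1 / Suc n" "\<And>n. f (x n) = 0"
    by metis
  have "x \<longlonglongrightarrow> t"
  proof (rule tendsto_sandwich[of "\<lambda>_. t" _ _ "\<lambda>n. t + 1 / Suc n"])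
    show "(\<lambda>n. t + 1 / real (Suc n)) \<longlonglongrightarrow> t"
      using tendsto_add[OF tendsto_const LIMSEQ_inverse_real_of_nat, of t] by (simp add: inverse_eq_divide)
  qed (use x in \<open>auto intro!: always_eventually less_imp_le\<close>)
  then have "(f \<circ> x) \<longlonglongrightarrow> f t"
    using cont x by (auto simp: continuous_within_sequentially)
  then show ?thesis using x by (simp add: comp_def LIMSEQ_const_iff)
qed

text \<open>Transforms ignore null sets; continuity from the right at the single point
  \<open>t\<close> restores equality there. One-sided continuity is the form that the tails inherit
  from distribution functions.\<close>

lemma laplace_unique:
  fixes f g :: "real \<Rightarrow> real"
  assumes "\<And>s. s0 \<le> s \<Longrightarrow> has_laplace f s (F s)" "\<And>s. s0 \<le> s \<Longrightarrow> has_laplace g s (F s)"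
    and "continuous (at_right t) f" "continuous (at_right t) g" "0 \<le> t"
  shows "f t = g t"
proof -
  have "has_laplace (\<lambda>t. f t - g t) s 0" if "s0 \<le> s" for s
    using has_laplace_diff[OF assms(1,2)[OF that]] by simp
  from AE_zero_right_continuous[OF has_laplace_zero_imp_AE_zero[OF this]] show ?thesis
    using assms(3-) by (force intro: continuous_diff)
qed

section \<open>Existence of the waiting time density\<close>

text \<open>The hypothesis \<open>mono\<close> says that \<open>t powr (1 - \<beta>) * v n t\<close> is nondecreasing.  It bounds \<open>v n t\<close>
  by a multiple of the transform \<open>V s0 n\<close>, so that convergence of the transforms already gives
  locally uniform convergence of the series.\<close>

lemma alternating_series_has_laplace:
  fixes v :: "nat \<Rightarrow> real \<Rightarrow> real"
  assumes nonneg: "\<And>n t. 0 < t \<Longrightarrow> 0 \<le> v n t"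
    and mono: "\<And>n x t. 0 < x \<Longrightarrow> x \<le> t \<Longrightarrow> v n x \<le> v n t * (x / t) powr (\<beta> - 1)"
    and cont: "\<And>n. continuous_on {0<..} (v n)"
    and lap: "\<And>n s. s0 \<le> s \<Longrightarrow> has_laplace (v n) s (V s n)"
    and sum: "\<And>s. s0 \<le> s \<Longrightarrow> summable (V s)"
    and pos: "0 < \<beta>" "0 < s0"
  shows "weakly_singular \<beta> (\<lambda>t. \<Sum>n. (-1) ^ n * v n t)"
    and "\<And>s. s0 \<le> s \<Longrightarrow> has_laplace (\<lambda>t. \<Sum>n. (-1) ^ n * v n t) s (\<Sum>n. (-1) ^ n * V s n)"
proof -
  have summable: "summable (\<lambda>n. v n t)" if t: "0 < t" for t
  proof -
    \<comment> \<open>Comes from bounding the transform at \<open>s0\<close> below by its part over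
      \<open>[t, t + 1]\<close>: the weight is at least \<open>exp (- s0 * (t + 1))\<close> there,
      and \<open>mono\<close> costs at most the factor \<open>t / (t + 1)\<close>.\<close>
    define K where "K = exp (- s0 * (t + 1)) * (t / (t + 1))"
    have "0 < K" using t by (simp add: K_def)
    have le: "K * v n t \<le> V s0 n" for n
    proof -
      have V: "integrable lborel (\<lambda>x. indicator {0<..} x * (exp (- s0 * x) * v n x))"
        "(LINT x|lborel. indicator {0<..} x * (exp (- s0 * x) * v n x)) = V s0 n"
        using lap[of s0 n] by (auto simp: has_laplace_def has_bochner_integral_iff)
      have lower: "K * v n t \<le> exp (- s0 * x) * v n x" if x: "t \<le> x" "x \<le> t + 1" for x
      proof -
        have "v n t \<le> v n x * (t / x) powr (\<beta> - 1)" using mono[of t x n] t x by simp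
        \<comment> \<open>As \<open>t / x\<close> is at most 1, lowering the exponent from
          \<open>\<beta> - 1\<close> to -1 can only increase the power, and the estimate becomes
          free of \<beta>.\<close>
        also have "\<dots> \<le> v n x * (t / x) powr (- 1)"
          using t x pos nonneg by (intro mult_left_mono powr_mono') auto
        also have "\<dots> = v n x * (x / t)" using t x by (simp add: powr_minus divide_simps)
        also have "\<dots> \<le> v n x * ((t + 1) / t)"
          using t x nonneg by (intro mult_left_mono divide_right_mono) auto
        finally have 1: "v n t * (t / (t + 1)) \<le> v n x" using t by (simp add: field_simps)
        have 2: "exp (- s0 * (t + 1)) \<le> exp (- s0 * x)" using x pos by simp
        have "exp (- s0 * (t + 1)) * (v n t * (t / (t + 1))) \<le> exp (- s0 * x) * v n x"
          using 1 2 t nonneg by (intro mult_mono) auto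
        then show ?thesis by (simp add: K_def mult_ac)
      qed
      have "K * v n t = (LINT x|lborel. indicator {t..t + 1} x * (K * v n t))" by simp
      also have "\<dots> \<le> (LINT x|lborel. indicator {0<..} x * (exp (- s0 * x) * v n x))"
        using lower t nonneg V(1)
        by (intro integral_mono) (auto split: split_indicator)
      finally show ?thesis using V(2) by simp
    qed
    have "summable (\<lambda>n. V s0 n / K)" using sum[of s0] by (intro summable_divide) auto
    then show ?thesis
    proof (rule summable_comparison_test'[where N=0])
      fix n
      show "norm (v n t) \<le> V s0 n / K"
        using le[of n] nonneg[OF t] \<open>0 < K\<close> by (simp add: pos_le_divide_eq mult.commute)
    qed
  qed
  let ?F = "\<lambda>t. \<Sum>n. (-1) ^ n * v n t"
  have F_abs: "summable (\<lambda>n. norm ((-1) ^ n * v n t))" "norm (?F t) \<le> (\<Sum>n. v n t)" if "0 < t" for t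
  proof -
    have *: "norm ((-1) ^ n * v n t) = v n t" for n
      using nonneg[OF that] by (simp add: abs_mult power_abs)
    show "summable (\<lambda>n. norm ((-1) ^ n * v n t))" unfolding * using that by (rule summable)
    from summable_norm[OF this] show "norm (?F t) \<le> (\<Sum>n. v n t)" unfolding * .
  qed
  show "weakly_singular \<beta> ?F"
    unfolding weakly_singular_def
  proof (intro conjI allI impI)
    have "isCont ?F t" if t: "0 < t" for t
    proof -
      define T where "T = t + 1"
      have T: "0 < T" "t < T" using t by (auto simp: T_def)
      \<comment> \<open>The factor \<open>x powr (1 - \<beta>)\<close> removes the singularity at 0
        and makes the absolute value of each term largest at \<open>T\<close>, so one majorant
        serves the whole of \<open>(0, T]\<close>.\<close>
      let ?g = "\<lambda>n x. (-1) ^ n * (x powr (1 - \<beta>) * v n x)"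
      have "uniform_limit {0<..T} (\<lambda>n x. \<Sum>i<n. ?g i x) (\<lambda>x. \<Sum>i. ?g i x) sequentially"
      proof (rule Weierstrass_m_test)
        fix n x assume x: "x \<in> {0<..T}"
        have "x powr (1 - \<beta>) * v n x \<le> x powr (1 - \<beta>) * (v n T * (x / T) powr (\<beta> - 1))"
          using mono[of x T n] x by (intro mult_left_mono) auto
        also have "\<dots> = T powr (1 - \<beta>) * v n T"
        proof -
          have "(x / T) powr (\<beta> - 1) = x powr (\<beta> - 1) * T powr (1 - \<beta>)"
            using x T powr_minus_divide[of T "\<beta> - 1"] by (simp add: powr_divide)
          moreover have "x powr (1 - \<beta>) * x powr (\<beta> - 1) = 1"
            using x by (simp flip: powr_add)
          ultimately show ?thesis by (simp add: mult_ac)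
        qed
        finally show "norm (?g n x) \<le> T powr (1 - \<beta>) * v n T"
          using nonneg[of x n] x by (simp add: abs_mult power_abs)
      qed (intro summable_mult summable T)
      then have "continuous_on {0<..T} (\<lambda>x. \<Sum>i. ?g i x)"
        by (rule uniform_limit_theorem[rotated])
           (auto intro!: always_eventually continuous_on_sum continuous_on_mult continuous_on_powr'
             continuous_on_const continuous_on_id continuous_on_subset[OF cont])
      then have "continuous_on {0<..T} (\<lambda>x. x powr (\<beta> - 1) * (\<Sum>i. ?g i x))"
        by (intro continuous_on_mult continuous_on_powr' continuous_on_const continuous_on_id) auto
      moreover have "x powr (\<beta> - 1) * (\<Sum>i. ?g i x) = ?F x" if "x \<in> {0<..T}" for x
      proof -
        have "(\<Sum>i. ?g i x) = (\<Sum>i. x powr (1 - \<beta>) * ((-1) ^ i * v i x))"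
          by (simp only: mult_ac)
        also have "\<dots> = x powr (1 - \<beta>) * ?F x"
          by (rule suminf_mult[OF summable_norm_cancel[OF F_abs(1)]]) (use that in simp)
        finally have "x powr (\<beta> - 1) * (\<Sum>i. ?g i x) = (x powr (\<beta> - 1) * x powr (1 - \<beta>)) * ?F x"
          by (simp only: mult.assoc)
        also have "x powr (\<beta> - 1) * x powr (1 - \<beta>) = 1" using that by (simp flip: powr_add)
        finally show ?thesis by simp
      qed
      ultimately have "continuous_on {0<..T} ?F"
        by (rule continuous_on_eq)
      then have "continuous_on {0<..<T} ?F" by (rule continuous_on_subset) auto
      then show ?thesis using T t by (simp add: continuous_on_eq_continuous_at)
    qed
    then show "continuous_on {0<..} ?F" by (simp add: continuous_on_eq_continuous_at)
  next
    fix T :: real assume T: "0 < T"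
    show "\<exists>C. \<forall>t. 0 < t \<and> t \<le> T \<longrightarrow> \<bar>?F t\<bar> \<le> C * t powr (\<beta> - 1)"
    proof (intro exI allI impI)
      fix t assume t: "0 < t \<and> t \<le> T"
      have "\<bar>?F t\<bar> \<le> (\<Sum>n. v n t)" using F_abs(2)[of t] t by simp
      also have "\<dots> \<le> (\<Sum>n. v n T * (t / T) powr (\<beta> - 1))"
        by (intro suminf_le summable summable_mult2) (use t T mono[of t T] in auto)
      also have "\<dots> = (\<Sum>n. v n T) * (t / T) powr (\<beta> - 1)"
        using T by (intro suminf_mult2[symmetric] summable)
      also have "\<dots> = ((\<Sum>n. v n T) / T powr (\<beta> - 1)) * t powr (\<beta> - 1)"
        using t T by (simp add: powr_divide)
      finally show "\<bar>?F t\<bar> \<le> ((\<Sum>n. v n T) / T powr (\<beta> - 1)) * t powr (\<beta> - 1)" .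
    qed
  qed
  fix s assume s: "s0 \<le> s"
  let ?h = "\<lambda>n t. indicator {0<..} t * (exp (- s * t) * ((-1) ^ n * v n t))"
  have lap': "has_laplace (\<lambda>t. (-1) ^ n * v n t) s ((-1) ^ n * V s n)" for n
    using lap[OF s] by (rule has_laplace_cmult)
  have int: "integrable lborel (?h n)" "(LINT t|lborel. ?h n t) = (-1) ^ n * V s n" for n
    using lap'[of n] by (simp_all add: has_laplace_def has_bochner_integral_iff)
  have norm_h: "norm (?h n t) = indicator {0<..} t * (exp (- s * t) * v n t)" for n t
    using nonneg[of t n] by (auto simp: abs_mult power_abs split: split_indicator)
  \<comment> \<open>The signs disappear in the norm, so the integrals of the norms form the
    convergent series of the \<open>V s n\<close>; this justifies integration term by term.\<close>
  have norm_int: "(LINT t|lborel. norm (?h n t)) = V s n" for n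
    unfolding norm_h using lap[OF s, of n] by (simp add: has_laplace_def has_bochner_integral_iff)
  have AE: "AE t in lborel. summable (\<lambda>n. norm (?h n t))"
    unfolding norm_h
    by (intro AE_I2) (auto intro!: summable_mult summable split: split_indicator)
  have sums: "summable (\<lambda>n. LINT t|lborel. norm (?h n t))"
    unfolding norm_int using s by (rule sum)
  have eq: "(\<Sum>n. ?h n t) = indicator {0<..} t * (exp (- s * t) * ?F t)" for t
  proof (cases "0 < t")
    case True
    have "(\<Sum>n. exp (- s * t) * ((-1) ^ n * v n t)) = exp (- s * t) * ?F t"
      by (rule suminf_mult[OF summable_norm_cancel[OF F_abs(1)[OF True]]])
    then show ?thesis using True by simp
  qed simp
  show "has_laplace ?F s (\<Sum>n. (-1) ^ n * V s n)"
    using integrable_suminf[OF int(1) AE sums] integral_suminf[OF int(1) AE sums]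
    unfolding eq int(2) has_laplace_def has_bochner_integral_iff by simp
qed

text \<open>Dividing by \<open>C\<^sub>2 * s powr \<alpha>\<^sub>2\<close> turns the quotient into
  \<open>d * s powr (- \<alpha>\<^sub>2) / (1 + X s)\<close>, where \<open>X s\<close> tends to 0.
  The geometric series in \<open>- X s\<close> and the binomial theorem leave only negative powers
  of \<open>s\<close>, each the transform of a power of \<open>t\<close>.\<close>

lemma exists_weakly_singular_has_laplace:
  fixes \<alpha>\<^sub>1 \<alpha>\<^sub>2 C\<^sub>1 C\<^sub>2 r :: real
  assumes "0 < \<alpha>\<^sub>1" "\<alpha>\<^sub>1 < \<alpha>\<^sub>2" "0 \<le> C\<^sub>1" "0 < C\<^sub>2" "0 < r"
  obtains f s0 where "0 < s0" "weakly_singular \<alpha>\<^sub>2 f"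
    "\<And>s. s0 \<le> s \<Longrightarrow> has_laplace f s (r / (r + (C\<^sub>1 * s powr \<alpha>\<^sub>1 + C\<^sub>2 * s powr \<alpha>\<^sub>2)))"
proof -
  define \<delta> where "\<delta> = \<alpha>\<^sub>2 - \<alpha>\<^sub>1"
  define c where "c = C\<^sub>1 / C\<^sub>2"
  define d where "d = r / C\<^sub>2"
  have cd: "0 \<le> c" "0 < d" and \<delta>: "0 < \<delta>" using assms by (auto simp: c_def d_def \<delta>_def)
  define X where "X = (\<lambda>s. c * s powr (- \<delta>) + d * s powr (- \<alpha>\<^sub>2))"
  have "(X \<longlongrightarrow> c * 0 + d * 0) at_top"
    unfolding X_def using \<delta> assms by (intro tendsto_intros tendsto_neg_powr filterlim_ident) auto
  then have "eventually (\<lambda>s. X s < 1) at_top"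
    by (rule order_tendstoD) simp
  then obtain S where S: "\<And>s. S \<le> s \<Longrightarrow> X s < 1" by (auto simp: eventually_at_top_linorder)
  define s0 where "s0 = max 1 S"
  have s0: "0 < s0" "\<And>s. s0 \<le> s \<Longrightarrow> X s < 1" "\<And>s. s0 \<le> s \<Longrightarrow> 0 < s" using S by (auto simp: s0_def)
  have X_nonneg: "0 \<le> X s" for s using cd by (simp add: X_def)
  \<comment> \<open>\<open>- e n j\<close> is the exponent of \<open>s\<close> in the term of
    \<open>s powr (- \<alpha>\<^sub>2) * X s ^ n\<close> where \<open>j\<close> factors contribute
    \<open>s powr (- \<delta>)\<close> and \<open>n - j\<close> contribute
    \<open>s powr (- \<alpha>\<^sub>2)\<close>. Since \<open>e n j\<close> is never below
    \<open>\<alpha>\<^sub>2\<close>, the monotonicity hypothesis of the series lemma holds with that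
    exponent for all terms at once.\<close>
  define e where "e = (\<lambda>n j :: nat. \<alpha>\<^sub>2 + j * \<delta> + real (n - j) * \<alpha>\<^sub>2)"
  have e: "\<alpha>\<^sub>2 \<le> e n j" "0 < e n j" for n j using \<delta> assms by (auto simp: e_def add_pos_nonneg)
  define a where "a = (\<lambda>n j :: nat. real (n choose j) * c ^ j * d ^ (n - j))"
  have a: "0 \<le> a n j" for n j using cd by (simp add: a_def)
  define v where "v = (\<lambda>n t. \<Sum>j\<le>n. a n j * (t powr (e n j - 1) / Gamma (e n j)))"
  have G: "0 < Gamma (e n j)" for n j using e(2) by (rule Gamma_real_pos)
  have lap_v: "has_laplace (v n) s (s powr (- \<alpha>\<^sub>2) * X s ^ n)" if "s0 \<le> s" for n s
  proof -
    have "has_laplace (v n) s (\<Sum>j\<le>n. a n j * s powr (- e n j))"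
      unfolding v_def using s0(3)[OF that] e by (intro has_laplace_sum has_laplace_cmult has_laplace_powr)
    also have "(\<Sum>j\<le>n. a n j * s powr (- e n j)) = (\<Sum>j\<le>n. s powr (- \<alpha>\<^sub>2) *
        (real (n choose j) * (c * s powr (- \<delta>)) ^ j * (d * s powr (- \<alpha>\<^sub>2)) ^ (n - j)))"
    proof (intro sum.cong refl)
      fix j
      have "s powr (- e n j) = s powr (- \<alpha>\<^sub>2) * (s powr (- \<delta>)) ^ j * (s powr (- \<alpha>\<^sub>2)) ^ (n - j)"
      proof -
        have "(s powr x) ^ m = s powr (m * x)" for x :: real and m :: nat
          using s0(3)[OF that] by (simp add: powr_power mult.commute)
        then show ?thesis by (simp add: e_def algebra_simps flip: powr_add)
      qed
      then show "a n j * s powr (- e n j) = s powr (- \<alpha>\<^sub>2) *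
        (real (n choose j) * (c * s powr (- \<delta>)) ^ j * (d * s powr (- \<alpha>\<^sub>2)) ^ (n - j))"
        by (simp add: a_def power_mult_distrib mult_ac)
    qed
    also have "\<dots> = s powr (- \<alpha>\<^sub>2) * X s ^ n"
      by (simp only: X_def binomial_ring sum_distrib_left)
    finally show ?thesis .
  qed
  have summ: "summable (\<lambda>n. s powr (- \<alpha>\<^sub>2) * X s ^ n)" if "s0 \<le> s" for s
    using s0(2)[OF that] X_nonneg by (intro summable_mult summable_geometric) auto
  have v_mono: "v n x \<le> v n t * (x / t) powr (\<alpha>\<^sub>2 - 1)" if "0 < x" "x \<le> t" for n x t
    unfolding v_def sum_distrib_right
  proof (intro sum_mono)
    fix j
    have "x powr (e n j - 1) = t powr (e n j - 1) * (x / t) powr (e n j - 1)"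
      using that by (simp add: powr_divide)
    also have "\<dots> \<le> t powr (e n j - 1) * (x / t) powr (\<alpha>\<^sub>2 - 1)"
      using that e by (intro mult_left_mono powr_mono') auto
    finally have "(a n j / Gamma (e n j)) * x powr (e n j - 1)
        \<le> (a n j / Gamma (e n j)) * (t powr (e n j - 1) * (x / t) powr (\<alpha>\<^sub>2 - 1))"
      using a G less_imp_le by (intro mult_left_mono divide_nonneg_pos) auto
    then show "a n j * (x powr (e n j - 1) / Gamma (e n j))
        \<le> a n j * (t powr (e n j - 1) / Gamma (e n j)) * (x / t) powr (\<alpha>\<^sub>2 - 1)"
      by (simp add: mult_ac)
  qed
  have v_cont: "continuous_on {0<..} (v n)" for n
    unfolding v_def using less_imp_neq[OF G]
    by (auto intro!: continuous_on_sum continuous_on_mult continuous_on_divide continuous_on_powr'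
        continuous_on_const continuous_on_id)
  have v_nonneg: "0 \<le> v n t" for n t
    unfolding v_def using a G less_imp_le by (intro sum_nonneg mult_nonneg_nonneg divide_nonneg_pos) auto
  note series = alternating_series_has_laplace[OF v_nonneg v_mono v_cont lap_v summ _ s0(1)]
  let ?F = "\<lambda>t. \<Sum>n. (-1) ^ n * v n t"
  have "0 < \<alpha>\<^sub>2" using assms by simp
  show thesis
  proof (rule that[OF s0(1)])
    have F: "weakly_singular \<alpha>\<^sub>2 ?F" by (rule series(1)) (use \<open>0 < \<alpha>\<^sub>2\<close> in auto)
    show "weakly_singular \<alpha>\<^sub>2 (\<lambda>t. d * ?F t)"
      unfolding weakly_singular_def
    proof (intro conjI allI impI)
      show "continuous_on {0<..} (\<lambda>t. d * ?F t)"
        using F by (intro continuous_on_mult continuous_on_const) (simp add: weakly_singular_def)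
      fix T :: real assume "0 < T"
      with F obtain C where C: "\<And>t. 0 < t \<and> t \<le> T \<Longrightarrow> \<bar>?F t\<bar> \<le> C * t powr (\<alpha>\<^sub>2 - 1)"
        unfolding weakly_singular_def by blast
      show "\<exists>C. \<forall>t. 0 < t \<and> t \<le> T \<longrightarrow> \<bar>d * ?F t\<bar> \<le> C * t powr (\<alpha>\<^sub>2 - 1)"
        using mult_left_mono[OF C, of _ d] cd by (intro exI[of _ "d * C"]) (auto simp: abs_mult mult_ac)
    qed
    fix s assume s: "s0 \<le> s"
    have "has_laplace ?F s (\<Sum>n. (-1) ^ n * (s powr (- \<alpha>\<^sub>2) * X s ^ n))"
      by (rule series(2)) (use \<open>0 < \<alpha>\<^sub>2\<close> s in auto)
    also have "(\<Sum>n. (-1) ^ n * (s powr (- \<alpha>\<^sub>2) * X s ^ n)) = (\<Sum>n. s powr (- \<alpha>\<^sub>2) * (- X s) ^ n)"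
      by (subst power_minus) (simp only: mult_ac)
    also have "\<dots> = s powr (- \<alpha>\<^sub>2) * (1 / (1 - (- X s)))"
      using s0(2)[OF s] X_nonneg[of s]
      by (subst suminf_mult) (auto simp: suminf_geometric summable_geometric)
    finally have "has_laplace (\<lambda>t. d * ?F t) s (d * (s powr (- \<alpha>\<^sub>2) * (1 / (1 - (- X s)))))"
      by (rule has_laplace_cmult)
    also have "d * (s powr (- \<alpha>\<^sub>2) * (1 / (1 - (- X s)))) =
        r / (r + (C\<^sub>1 * s powr \<alpha>\<^sub>1 + C\<^sub>2 * s powr \<alpha>\<^sub>2))"
    proof -
      have p: "0 < s powr \<alpha>\<^sub>2" "s powr (- \<alpha>\<^sub>2) = 1 / s powr \<alpha>\<^sub>2" "s powr (- \<delta>) = s powr \<alpha>\<^sub>1 / s powr \<alpha>\<^sub>2"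
        using s0(3)[OF s] by (auto simp: powr_minus_divide powr_diff \<delta>_def)
      have "1 - (- X s) = (r + (C\<^sub>1 * s powr \<alpha>\<^sub>1 + C\<^sub>2 * s powr \<alpha>\<^sub>2)) / (C\<^sub>2 * s powr \<alpha>\<^sub>2)"
        unfolding X_def p(2,3) c_def d_def using p(1) assms by (simp add: field_simps)
      then show ?thesis unfolding p(2) d_def using p(1) assms by (simp add: field_simps)
    qed
    finally show "has_laplace (\<lambda>t. d * ?F t) s (r / (r + (C\<^sub>1 * s powr \<alpha>\<^sub>1 + C\<^sub>2 * s powr \<alpha>\<^sub>2)))" .
  qed
qed

text \<open>Iterated convolution with \<open>f\<close>: exponents add up, and
  \<open>weakly_singular_mono\<close> brings them back to \<beta>, so the induction hypothesis keeps
  its form.\<close>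

lemma exists_has_laplace_power:
  assumes "0 < \<beta>" "weakly_singular \<beta> f" "\<And>s. s0 \<le> s \<Longrightarrow> has_laplace f s (G s)"
  shows "\<exists>F. weakly_singular \<beta> F \<and> (\<forall>s\<ge>s0. has_laplace F s (G s ^ Suc k))"
proof (induction k)
  case 0
  then show ?case using assms by auto
next
  case (Suc k)
  then obtain F where F: "weakly_singular \<beta> F" "\<And>s. s0 \<le> s \<Longrightarrow> has_laplace F s (G s ^ Suc k)"
    by auto
  have "weakly_singular \<beta> (conv f F)"
    using weakly_singular_conv(1)[OF assms(2) F(1) assms(1) assms(1)]
    by (rule weakly_singular_mono) (use assms(1) in simp)
  moreover have "has_laplace (conv f F) s (G s ^ Suc (Suc k))" if "s0 \<le> s" for s
    using has_laplace_conv[OF assms(3) F(2)] that by simp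
  ultimately show ?case by blast
qed

section \<open>Poisson processes at independent times\<close>

text \<open>A Poisson process is a Levy process through \<open>real (N t \<omega>)\<close>, so
  measurability into the naturals is recovered by taking the floor; then its law can be evaluated on
  singletons.\<close>

lemma (in prob_space) emeasure_poisson_process_eq:
  assumes N: "poisson_process M r N" and "0 < r" "0 < t"
  shows "N t \<in> measurable M (count_space UNIV)"
    and "emeasure M {\<omega> \<in> space M. N t \<omega> = k} = ennreal ((r * t) ^ k / fact k * exp (- (r * t)))"
proof -
  have "(\<lambda>\<omega>. real (N t \<omega>)) \<in> borel_measurable M"
    using assms by (auto simp: poisson_process_def levy_process_def)
  then have "(\<lambda>\<omega>. nat \<lfloor>real (N t \<omega>)\<rfloor>) \<in> measurable M (count_space UNIV)"
    by measurable
  then show [measurable]: "N t \<in> measurable M (count_space UNIV)" by simp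
  have "emeasure M {\<omega> \<in> space M. N t \<omega> = k} = emeasure (distr M (count_space UNIV) (N t)) {k}"
    by (subst emeasure_distr) (auto intro!: arg_cong2[where f=emeasure])
  also have "\<dots> = emeasure (measure_pmf (poisson_pmf (r * t))) {k}"
    using assms by (simp add: poisson_process_def)
  also have "\<dots> = ennreal ((r * t) ^ k / fact k * exp (- (r * t)))"
    using assms by (simp add: emeasure_pmf_single)
  finally show "emeasure M {\<omega> \<in> space M. N t \<omega> = k} = ennreal ((r * t) ^ k / fact k * exp (- (r * t)))" .
qed

text \<open>Independence is assumed for one time of \<open>N\<close> at once.  It applies to the approximations
  \<open>D m\<close> of \<open>Z\<close> from the right, which take countably many values, and right-continuity of
  the paths of \<open>N\<close> carries the result over to \<open>Z\<close>.\<close>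

lemma (in prob_space) poisson_process_at_independent_time:
  fixes Z :: "'a \<Rightarrow> real" and k :: nat
  assumes N: "poisson_process M r N" and r: "0 < r"
    and Z [measurable]: "Z \<in> borel_measurable M" and Z_nonneg: "\<And>\<omega>. \<omega> \<in> space M \<Longrightarrow> 0 \<le> Z \<omega>"
    and indep: "\<And>t k A. 0 < t \<Longrightarrow> A \<in> sets borel \<Longrightarrow>
      prob ({\<omega> \<in> space M. N t \<omega> = k} \<inter> {\<omega> \<in> space M. Z \<omega> \<in> A}) =
      prob {\<omega> \<in> space M. N t \<omega> = k} * prob {\<omega> \<in> space M. Z \<omega> \<in> A}"
  shows "prob {\<omega> \<in> space M. N (Z \<omega>) \<omega> = k} =
    expectation (\<lambda>\<omega>. (r * Z \<omega>) ^ k / fact k * exp (- (r * Z \<omega>)))"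
proof -
  define q where "q = (\<lambda>u. (r * u) ^ k / fact k * exp (- (r * u)))"
  have q_cont: "isCont q u" for u unfolding q_def by (intro continuous_intros) auto
  have [measurable]: "q \<in> borel_measurable borel" unfolding q_def by measurable
  have N_meas [measurable]: "N t \<in> measurable M (count_space UNIV)" if "0 < t" for t
    using emeasure_poisson_process_eq(1)[OF N r that] .
  have q: "emeasure M {\<omega> \<in> space M. N t \<omega> = k} = ennreal (q t)" if "0 < t" for t
    using emeasure_poisson_process_eq(2)[OF N r that] by (simp add: q_def)
  have q_bound: "0 \<le> q u" "q u \<le> 1" if "0 < u" for u
  proof -
    show "0 \<le> q u" using r that by (simp add: q_def)
    have "ennreal (q u) \<le> 1" using q[OF that, symmetric] by (simp add: emeasure_le_1)
    then show "q u \<le> 1" using \<open>0 \<le> q u\<close> by simp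
  qed
  \<comment> \<open>The least multiple of \<open>1 / (m + 1)\<close> strictly above
    \<open>Z\<close>. Strictness fits right-continuity and ensures \<open>D m \<omega> > 0\<close>,
    where the Poisson law is prescribed.\<close>
  define D where "D = (\<lambda>m \<omega>. (real (nat \<lfloor>real (Suc m) * Z \<omega>\<rfloor>) + 1) / real (Suc m))"
  have D: "Z \<omega> < D m \<omega>" "D m \<omega> \<le> Z \<omega> + 1 / real (Suc m)" if "\<omega> \<in> space M" for \<omega> m
  proof -
    have "real (nat \<lfloor>real (Suc m) * Z \<omega>\<rfloor>) = of_int \<lfloor>real (Suc m) * Z \<omega>\<rfloor>"
      using Z_nonneg[OF that] by (simp del: of_nat_Suc)
    moreover have "real (Suc m) * Z \<omega> < of_int \<lfloor>real (Suc m) * Z \<omega>\<rfloor> + 1"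
      "of_int \<lfloor>real (Suc m) * Z \<omega>\<rfloor> \<le> real (Suc m) * Z \<omega>" by linarith+
    ultimately show "Z \<omega> < D m \<omega>" "D m \<omega> \<le> Z \<omega> + 1 / real (Suc m)"
      unfolding D_def by (simp_all add: field_simps del: of_nat_Suc)
  qed
  have D_pos: "0 < D m \<omega>" if "\<omega> \<in> space M" for \<omega> m using D(1)[OF that] Z_nonneg[OF that] by (rule le_less_trans[rotated])
  have D_lim: "(\<lambda>m. D m \<omega>) \<longlonglongrightarrow> Z \<omega>" if "\<omega> \<in> space M" for \<omega>
  proof (rule tendsto_sandwich[of "\<lambda>_. Z \<omega>" _ _ "\<lambda>m. Z \<omega> + 1 / real (Suc m)"])
    show "(\<lambda>m. Z \<omega> + 1 / real (Suc m)) \<longlonglongrightarrow> Z \<omega>"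
      using tendsto_add[OF tendsto_const LIMSEQ_inverse_real_of_nat, of "Z \<omega>"] by (simp add: inverse_eq_divide)
  qed (use D[OF that] in \<open>auto intro!: always_eventually less_imp_le simp del: of_nat_Suc\<close>)
  have [measurable]: "D m \<in> borel_measurable M" for m unfolding D_def by measurable
  define A where "A = (\<lambda>m. {\<omega> \<in> space M. N (D m \<omega>) \<omega> = k})"
  have A: "A m \<in> sets M" "emeasure M (A m) = (\<integral>\<^sup>+\<omega>. ennreal (q (D m \<omega>)) \<partial>M)" for m
  proof -
    define t where "t = (\<lambda>i. (real i + 1) / real (Suc m))"
    have t: "0 < t i" for i by (simp add: t_def)
    define J where "J = (\<lambda>i. {\<omega> \<in> space M. nat \<lfloor>real (Suc m) * Z \<omega>\<rfloor> = i})"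
    have J [measurable]: "J i \<in> sets M" for i unfolding J_def by measurable
    have J_alt: "J i = {\<omega> \<in> space M. Z \<omega> \<in> {z. nat \<lfloor>real (Suc m) * z\<rfloor> = i}}" for i by (simp add: J_def)
    have borel_J: "{z. nat \<lfloor>real (Suc m) * z\<rfloor> = i} \<in> sets borel" for i by measurable
    have B: "{\<omega> \<in> space M. N (t i) \<omega> = k} \<inter> J i \<in> sets M" for i
      using N_meas[OF t] by measurable
    have A_eq: "A m = (\<Union>i. {\<omega> \<in> space M. N (t i) \<omega> = k} \<inter> J i)"
      by (auto simp: A_def J_def D_def t_def)
    show "A m \<in> sets M" unfolding A_eq using B by blast
    have "emeasure M (A m) = (\<Sum>i. emeasure M ({\<omega> \<in> space M. N (t i) \<omega> = k} \<inter> J i))"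
      unfolding A_eq using B
      by (intro suminf_emeasure[symmetric]) (auto simp: disjoint_family_on_def J_def)
    also have "\<dots> = (\<Sum>i. ennreal (q (t i)) * emeasure M (J i))"
    proof (intro arg_cong[where f=suminf] ext)
      fix i
      show "emeasure M ({\<omega> \<in> space M. N (t i) \<omega> = k} \<inter> J i) = ennreal (q (t i)) * emeasure M (J i)"
        unfolding q[OF t, symmetric] emeasure_eq_measure
        using indep[OF t borel_J[of i], of i k] unfolding J_alt
        by (simp add: ennreal_mult)
    qed
    also have "\<dots> = (\<integral>\<^sup>+\<omega>. (\<Sum>i. ennreal (q (t i)) * indicator (J i) \<omega>) \<partial>M)"
      by (subst nn_integral_suminf) (simp_all add: nn_integral_cmult_indicator)
    also have "\<dots> = (\<integral>\<^sup>+\<omega>. ennreal (q (D m \<omega>)) \<partial>M)"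
    proof (rule nn_integral_cong)
      fix \<omega> assume \<omega>: "\<omega> \<in> space M"
      let ?i = "nat \<lfloor>real (Suc m) * Z \<omega>\<rfloor>"
      have "(\<Sum>i. ennreal (q (t i)) * indicator (J i) \<omega>) = (\<Sum>i\<in>{?i}. ennreal (q (t i)) * indicator (J i) \<omega>)"
        by (rule suminf_finite) (auto simp: J_def)
      also have "\<dots> = ennreal (q (D m \<omega>))" using \<omega> by (simp add: J_def t_def D_def)
      finally show "(\<Sum>i. ennreal (q (t i)) * indicator (J i) \<omega>) = ennreal (q (D m \<omega>))" .
    qed
    finally show "emeasure M (A m) = (\<integral>\<^sup>+\<omega>. ennreal (q (D m \<omega>)) \<partial>M)" .
  qed
  have q_int: "integrable M (\<lambda>\<omega>. q (D m \<omega>))" for m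
    by (rule integrable_const_bound[where B=1]) (auto intro!: AE_I2 simp: q_bound D_pos)
  have prob_A: "prob (A m) = expectation (\<lambda>\<omega>. q (D m \<omega>))" for m
  proof -
    have "ennreal (prob (A m)) = ennreal (expectation (\<lambda>\<omega>. q (D m \<omega>)))"
      using A(2)[of m] q_int q_bound D_pos
      by (subst (asm) nn_integral_eq_integral) (auto intro!: AE_I2 simp: emeasure_eq_measure)
    then show ?thesis
      using q_bound D_pos by (subst (asm) ennreal_inj) (auto intro!: Bochner_Integration.integral_nonneg)
  qed
  define A0 where "A0 = {\<omega> \<in> space M. N (Z \<omega>) \<omega> = k}"
  \<comment> \<open>A right-continuous path with integer values is constant immediately to the right
    of \<open>Z \<omega>\<close>.\<close>
  have ev: "eventually (\<lambda>m. N (D m \<omega>) \<omega> = N (Z \<omega>) \<omega>) sequentially" if \<omega>: "\<omega> \<in> space M" for \<omega>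
  proof -
    have "continuous (at_right (Z \<omega>)) (\<lambda>t. real (N t \<omega>))"
      using N \<omega> Z_nonneg[OF \<omega>] by (auto simp: poisson_process_def levy_process_def cadlag_on_nonneg_def)
    then have "((\<lambda>t. real (N t \<omega>)) \<circ> (\<lambda>m. D m \<omega>)) \<longlonglongrightarrow> real (N (Z \<omega>) \<omega>)"
      using D(1)[OF \<omega>] D_lim[OF \<omega>] by (simp add: continuous_within_sequentially)
    then have "eventually (\<lambda>m. \<bar>real (N (D m \<omega>) \<omega>) - real (N (Z \<omega>) \<omega>)\<bar> < 1) sequentially"
      by (auto dest: tendstoD[where e=1] simp: dist_real_def)
    then show ?thesis by eventually_elim linarith
  qed
  have ind_lim: "(\<lambda>m. indicator (A m) \<omega> :: real) \<longlonglongrightarrow> indicator A0 \<omega>" if "\<omega> \<in> space M" for \<omega>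
    using ev[OF that] by (intro tendsto_eventually) (auto simp: A_def A0_def elim!: eventually_mono split: split_indicator)
  \<comment> \<open>Measurability of the event for \<open>Z\<close> itself also comes from the
    approximation: its indicator is a pointwise limit of those of the \<open>A m\<close>.\<close>
  have ind_meas: "(indicator A0 :: 'a \<Rightarrow> real) \<in> borel_measurable M"
    by (rule borel_measurable_LIMSEQ_real[OF ind_lim]) (use A(1) in auto)
  moreover have "A0 \<inter> space M = A0" by (auto simp: A0_def)
  ultimately have A0: "A0 \<in> sets M"
    by (subst (asm) borel_measurable_indicator_iff) simp
  have "(\<lambda>m. expectation (indicator (A m) :: _ \<Rightarrow> real)) \<longlonglongrightarrow> expectation (indicator A0)"
    by (rule integral_dominated_convergence[where w="\<lambda>_. 1" 
        and s="\<lambda>m. indicator (A m) :: 'a \<Rightarrow> real" and f="indicator A0"])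
       (use ind_meas A(1) ind_lim in \<open>auto intro!: AE_I2 split: split_indicator\<close>)
  then have "(\<lambda>m. expectation (\<lambda>\<omega>. q (D m \<omega>))) \<longlonglongrightarrow> prob A0"
    using A(1) A0 sets.sets_into_space by (simp add: prob_A[symmetric] Int_absorb2)
  moreover have "(\<lambda>m. expectation (\<lambda>\<omega>. q (D m \<omega>))) \<longlonglongrightarrow> expectation (\<lambda>\<omega>. q (Z \<omega>))"
    by (rule integral_dominated_convergence[where w="\<lambda>_. 1"])
       (use q_bound D_pos in \<open>auto intro!: AE_I2 isCont_tendsto_compose[OF q_cont] D_lim\<close>)
  ultimately have "prob A0 = expectation (\<lambda>\<omega>. q (Z \<omega>))" by (rule LIMSEQ_unique)
  then show ?thesis by (simp add: A0_def q_def)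
qed

section \<open>The inverse mixed stable subordinator\<close>

locale mixed_stable_clock = prob_space M for M :: "'a measure" +
  fixes L :: "real \<Rightarrow> 'a \<Rightarrow> real" and \<alpha>\<^sub>1 \<alpha>\<^sub>2 C\<^sub>1 C\<^sub>2 :: real
  assumes subordinator: "mixed_stable_subordinator M \<alpha>\<^sub>1 \<alpha>\<^sub>2 C\<^sub>1 C\<^sub>2 L"
    and coeffs: "0 \<le> C\<^sub>1" "0 < C\<^sub>2" "C\<^sub>1 + C\<^sub>2 = 1"
begin

definition \<phi> :: "real \<Rightarrow> real" where
  "\<phi> s = C\<^sub>1 * s powr \<alpha>\<^sub>1 + C\<^sub>2 * s powr \<alpha>\<^sub>2"

lemma \<phi>_nonneg: "0 \<le> \<phi> s"
  using coeffs by (simp add: \<phi>_def)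

lemma L_measurable [measurable]: "0 \<le> t \<Longrightarrow> L t \<in> borel_measurable M"
  using subordinator by (auto simp: mixed_stable_subordinator_def levy_subordinator_def levy_process_def)

lemma L_mono: "\<omega> \<in> space M \<Longrightarrow> 0 \<le> u \<Longrightarrow> u \<le> v \<Longrightarrow> L u \<omega> \<le> L v \<omega>"
  using subordinator
  by (auto simp: mixed_stable_subordinator_def levy_subordinator_def mono_on_def)

lemma L_nonneg: "\<omega> \<in> space M \<Longrightarrow> 0 \<le> u \<Longrightarrow> 0 \<le> L u \<omega>"
  using L_mono[of \<omega> 0 u] subordinator
  by (auto simp: mixed_stable_subordinator_def levy_subordinator_def levy_process_def)

lemma L_laplace: "0 \<le> t \<Longrightarrow> 0 \<le> s \<Longrightarrow> expectation (\<lambda>\<omega>. exp (- s * L t \<omega>)) = exp (- t * \<phi> s)"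
  using subordinator by (simp add: mixed_stable_subordinator_def \<phi>_def)

lemma exp_L_integrable: "0 \<le> t \<Longrightarrow> 0 \<le> s \<Longrightarrow> integrable M (\<lambda>\<omega>. exp (- s * L t \<omega>))"
  by (rule integrable_const_bound[where B=1]) (auto intro!: AE_I2 simp: L_nonneg)

lemma real_inverse_subordinator_nonneg: "0 \<le> real_of_ereal (inverse_subordinator L t \<omega>)"
proof -
  have "0 \<le> inverse_subordinator L t \<omega>"
    unfolding inverse_subordinator_def by (intro INF_greatest) simp
  then show ?thesis by (rule real_of_ereal_pos)
qed

text \<open>Together with \<open>le_inverse_subordinatorI\<close>, this makes
  \<open>L u \<omega> \<le> t\<close> equivalent to \<open>u\<close> not exceeding the clock, up to
  ties and infinite clocks. An infinite clock is read as 0, so the two premises then contradict each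
  other.\<close>

lemma less_inverse_subordinatorD:
  assumes "0 \<le> u" "u < real_of_ereal (inverse_subordinator L t \<omega>)"
  shows "L u \<omega> \<le> t"
proof (rule ccontr)
  assume "\<not> L u \<omega> \<le> t"
  then have "inverse_subordinator L t \<omega> \<le> ereal u"
    unfolding inverse_subordinator_def using assms by (intro INF_lower) auto
  then have "real_of_ereal (inverse_subordinator L t \<omega>) \<le> u"
    using assms(1) by (cases "inverse_subordinator L t \<omega>") auto
  with assms show False by simp
qed

lemma le_inverse_subordinatorI:
  assumes "\<omega> \<in> space M" "0 \<le> u" "L u \<omega> \<le> t" "inverse_subordinator L t \<omega> \<noteq> \<infinity>"
  shows "u \<le> real_of_ereal (inverse_subordinator L t \<omega>)"
proof -
  have "ereal u \<le> inverse_subordinator L t \<omega>"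
    unfolding inverse_subordinator_def
  proof (rule INF_greatest)
    fix v assume v: "v \<in> {u. 0 \<le> u \<and> t < L u \<omega>}"
    have "u \<le> v"
    proof (rule ccontr)
      assume "\<not> u \<le> v"
      then have "L v \<omega> \<le> L u \<omega>" using assms v by (intro L_mono) auto
      with assms v show False by auto
    qed
    then show "ereal u \<le> ereal v" by simp
  qed
  then show ?thesis
    using assms(4) by (cases "inverse_subordinator L t \<omega>") auto
qed

text \<open>A path that never exceeds \<open>t\<close> has \<open>exp (t - L n \<omega>)\<close> at
  least 1 for every \<open>n\<close>. The mean of this variable is \<open>exp t * exp (- n)\<close>,
  because \<open>\<phi> 1 = C\<^sub>1 + C\<^sub>2 = 1\<close>, and it tends to 0. Integer times
  suffice, which keeps the event measurable.\<close>

lemma AE_inverse_subordinator_finite: "AE \<omega> in M. inverse_subordinator L t \<omega> \<noteq> \<infinity>"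
proof -
  define S where "S = {\<omega> \<in> space M. \<forall>n. L (real n) \<omega> \<le> t}"
  have S [measurable]: "S \<in> sets M" unfolding S_def by measurable
  have le: "prob S \<le> exp t * exp (- real n)" for n
  proof -
    have "prob S = expectation (indicator S)" using S by simp
    also have "\<dots> \<le> expectation (\<lambda>\<omega>. exp t * exp (- 1 * L (real n) \<omega>))"
    proof (rule integral_mono)
      show "integrable M (indicator S :: 'a \<Rightarrow> real)" using S by (simp add: emeasure_eq_measure)
      show "integrable M (\<lambda>\<omega>. exp t * exp (- 1 * L (real n) \<omega>))"
        by (intro integrable_mult_right exp_L_integrable) auto
      fix \<omega> assume "\<omega> \<in> space M"
      show "indicator S \<omega> \<le> exp t * exp (- 1 * L (real n) \<omega>)"
        by (auto simp: S_def split: split_indicator simp flip: exp_add)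
    qed
    also have "\<dots> = exp t * exp (- real n * \<phi> 1)"
      using L_laplace[of "real n" 1] by simp
    also have "\<phi> 1 = 1" using coeffs by (simp add: \<phi>_def)
    finally show ?thesis by simp
  qed
  have "(\<lambda>n. exp (- real n)) \<longlonglongrightarrow> 0"
    by (rule filterlim_compose[OF exp_at_bot])
       (simp add: filterlim_uminus_at_bot filterlim_real_sequentially)
  then have "(\<lambda>n. exp t * exp (- real n)) \<longlonglongrightarrow> exp t * 0"
    by (intro tendsto_intros)
  then have "prob S \<le> 0"
    using le by (intro LIMSEQ_le_const[of "\<lambda>n. exp t * exp (- real n)"]) auto
  then have "S \<in> null_sets M"
    using S measure_nonneg[of M S] by (simp add: null_sets_def emeasure_eq_measure)
  then have "AE \<omega> in M. \<omega> \<notin> S" by (rule AE_not_in)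
  with AE_space show ?thesis
  proof eventually_elim
    case (elim \<omega>)
    then obtain n :: nat where "t < L (real n) \<omega>" by (auto simp: S_def not_le)
    then have "inverse_subordinator L t \<omega> \<le> ereal (real n)"
      unfolding inverse_subordinator_def by (intro INF_lower) auto
    then show ?case by auto
  qed
qed

text \<open>Nothing is known about \<open>L u\<close> for \<open>u < 0\<close>; \<open>max 0 u\<close> makes \<open>passage\<close> measurable on the
  whole plane.\<close>

definition passage :: "real \<Rightarrow> real \<Rightarrow> real" where
  "passage u t = prob {\<omega> \<in> space M. L (max 0 u) \<omega> \<le> t}"

lemma passage_bounds: "0 \<le> passage u t" "passage u t \<le> 1"
  by (auto simp: passage_def)

text \<open>\<open>passage u\<close> is the distribution function of
  \<open>L (max 0 u)\<close>.\<close>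

lemma passage_right_continuous: "continuous (at_right t) (passage u)"
proof -
  interpret D: real_distribution "distr M borel (L (max 0 u))" by simp
  have "passage u = cdf (distr M borel (L (max 0 u)))"
  proof
    fix t
    show "passage u t = cdf (distr M borel (L (max 0 u))) t"
      unfolding passage_def cdf_def by (subst measure_distr) (auto intro!: arg_cong[where f=prob])
  qed
  then show ?thesis using D.cdf_is_right_cont by simp
qed

lemma passage_antimono: "u \<le> v \<Longrightarrow> passage v t \<le> passage u t"
  unfolding passage_def
proof (intro finite_measure_mono subsetI)
  fix \<omega> assume "u \<le> v" "\<omega> \<in> {\<omega> \<in> space M. L (max 0 v) \<omega> \<le> t}"
  then show "\<omega> \<in> {\<omega> \<in> space M. L (max 0 u) \<omega> \<le> t}"
    using L_mono[of \<omega> "max 0 u" "max 0 v"] max.mono[of 0 0 u v] by auto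
qed simp

lemma passage_measurable_fst [measurable]: "(\<lambda>u. passage u t) \<in> borel_measurable borel"
proof -
  have "mono (\<lambda>u. - passage u t)" by (intro monoI) (simp add: passage_antimono)
  then have "(\<lambda>u. - (- passage u t)) \<in> borel_measurable borel"
    by (intro borel_measurable_uminus borel_measurable_mono)
  then show ?thesis by simp
qed

text \<open>Rounding the second argument strictly up to a grid of mesh \<open>1 / (m + 1)\<close>
  leaves countably many sections, each measurable by monotonicity in the first; right-continuity
  handles the limit. Fubini needs this joint measurability.\<close>

lemma passage_measurable [measurable]:
  assumes [measurable]: "f \<in> borel_measurable N" "g \<in> borel_measurable N"
  shows "(\<lambda>x. passage (f x) (g x)) \<in> borel_measurable N"
proof (rule borel_measurable_LIMSEQ_real)
  let ?d = "\<lambda>m x. (real_of_int \<lfloor>real (Suc m) * g x\<rfloor> + 1) / real (Suc m)"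
  fix m
  have "(\<lambda>x. (\<lambda>i::int. \<lambda>x. passage (f x) ((real_of_int i + 1) / real (Suc m))) \<lfloor>real (Suc m) * g x\<rfloor> x)
      \<in> borel_measurable N"
    by (rule measurable_compose_countable) measurable
  then show "(\<lambda>x. passage (f x) (?d m x)) \<in> borel_measurable N" by simp
next
  let ?d = "\<lambda>m x. (real_of_int \<lfloor>real (Suc m) * g x\<rfloor> + 1) / real (Suc m)"
  fix x
  have d: "g x < ?d m x" "?d m x \<le> g x + 1 / real (Suc m)" for m
  proof -
    have "real (Suc m) * g x < of_int \<lfloor>real (Suc m) * g x\<rfloor> + 1"
      "of_int \<lfloor>real (Suc m) * g x\<rfloor> \<le> real (Suc m) * g x" by linarith+
    then show "g x < ?d m x" "?d m x \<le> g x + 1 / real (Suc m)"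
      by (simp_all add: field_simps del: of_nat_Suc)
  qed
  have "(\<lambda>m. ?d m x) \<longlonglongrightarrow> g x"
  proof (rule tendsto_sandwich[of "\<lambda>_. g x" _ _ "\<lambda>m. g x + 1 / real (Suc m)"])
    show "(\<lambda>m. g x + 1 / real (Suc m)) \<longlonglongrightarrow> g x"
      using tendsto_add[OF tendsto_const LIMSEQ_inverse_real_of_nat, of "g x"] by (simp add: inverse_eq_divide)
  qed (use d in \<open>auto intro!: always_eventually less_imp_le simp del: of_nat_Suc\<close>)
  then have "(passage (f x) \<circ> (\<lambda>m. ?d m x)) \<longlonglongrightarrow> passage (f x) (g x)"
    by (intro passage_right_continuous[unfolded continuous_within_sequentially, rule_format])
       (use d(1) in auto)
  then show "(\<lambda>m. passage (f x) (?d m x)) \<longlonglongrightarrow> passage (f x) (g x)" by (simp add: comp_def)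
qed

lemma nn_integral_exp_atLeast:
  fixes s a :: real
  assumes "0 < s"
  shows "(\<integral>\<^sup>+t. ennreal (exp (- s * t)) * indicator {a..} t \<partial>lborel) = ennreal (exp (- s * a) / s)"
proof -
  have "((\<lambda>t. - exp (- s * t) / s) \<longlongrightarrow> - 0 / s) at_top"
    using assms
    by (intro tendsto_intros filterlim_compose[OF exp_at_bot] filterlim_tendsto_neg_mult_at_bot[OF tendsto_const]
        filterlim_ident) auto
  then have "(\<integral>\<^sup>+t. ennreal (exp (- s * t)) * indicator {a..} t \<partial>lborel) = ennreal (- 0 / s - (- exp (- s * a) / s))"
    using assms by (intro nn_integral_FTC_atLeast) (auto intro!: derivative_eq_intros)
  then show ?thesis by simp
qed

text \<open>Integrating \<open>exp (- s * t)\<close> over \<open>t \<ge> L u \<omega>\<close> gives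
  \<open>exp (- s * L u \<omega>) / s\<close>, whose mean is given by the Laplace exponent; Tonelli
  interchanges the two integrations.\<close>

lemma passage_laplace:
  assumes "0 \<le> u" "0 < s"
  shows "(\<integral>\<^sup>+t. ennreal (indicator {0<..} t * exp (- s * t)) * ennreal (passage u t) \<partial>lborel)
    = ennreal (exp (- u * \<phi> s) / s)"
proof -
  interpret P: pair_sigma_finite M lborel ..
  have [measurable]: "L u \<in> borel_measurable M" using assms by simp
  have "(\<integral>\<^sup>+t. ennreal (indicator {0<..} t * exp (- s * t)) * ennreal (passage u t) \<partial>lborel)
    = (\<integral>\<^sup>+t. (\<integral>\<^sup>+\<omega>. ennreal (indicator {0<..} t * exp (- s * t)) * indicator {L u \<omega>..} t \<partial>M) \<partial>lborel)"
  proof (rule nn_integral_cong)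
    fix t :: real
    have "(\<integral>\<^sup>+\<omega>. ennreal (indicator {0<..} t * exp (- s * t)) * indicator {L u \<omega>..} t \<partial>M)
      = (\<integral>\<^sup>+\<omega>. ennreal (indicator {0<..} t * exp (- s * t)) * indicator {\<omega> \<in> space M. L u \<omega> \<le> t} \<omega> \<partial>M)"
      by (intro nn_integral_cong) (auto split: split_indicator)
    also have "\<dots> = ennreal (indicator {0<..} t * exp (- s * t)) * emeasure M {\<omega> \<in> space M. L u \<omega> \<le> t}"
      by (intro nn_integral_cmult_indicator) measurable
    finally show "ennreal (indicator {0<..} t * exp (- s * t)) * ennreal (passage u t) =
      (\<integral>\<^sup>+\<omega>. ennreal (indicator {0<..} t * exp (- s * t)) * indicator {L u \<omega>..} t \<partial>M)"
      using assms by (simp add: passage_def emeasure_eq_measure)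
  qed
  also have "\<dots> = (\<integral>\<^sup>+\<omega>. (\<integral>\<^sup>+t. ennreal (indicator {0<..} t * exp (- s * t)) * indicator {L u \<omega>..} t \<partial>lborel) \<partial>M)"
    unfolding indicator_def atLeast_def mem_Collect_eq by (rule P.Fubini') measurable
  also have "\<dots> = (\<integral>\<^sup>+\<omega>. ennreal (exp (- s * L u \<omega>) / s) \<partial>M)"
  proof (rule nn_integral_cong)
    fix \<omega> assume "\<omega> \<in> space M"
    then have L: "0 \<le> L u \<omega>" using L_nonneg assms by simp
    have "(\<integral>\<^sup>+t. ennreal (indicator {0<..} t * exp (- s * t)) * indicator {L u \<omega>..} t \<partial>lborel)
      = (\<integral>\<^sup>+t. ennreal (exp (- s * t)) * indicator {L u \<omega>..} t \<partial>lborel)"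
      using L AE_lborel_singleton[of 0]
      by (intro nn_integral_cong_AE) (auto elim!: eventually_mono split: split_indicator)
    also have "\<dots> = ennreal (exp (- s * L u \<omega>) / s)" by (rule nn_integral_exp_atLeast[OF assms(2)])
    finally show "(\<integral>\<^sup>+t. ennreal (indicator {0<..} t * exp (- s * t)) * indicator {L u \<omega>..} t \<partial>lborel)
      = ennreal (exp (- s * L u \<omega>) / s)" .
  qed
  also have "\<dots> = ennreal (expectation (\<lambda>\<omega>. exp (- s * L u \<omega>) / s))"
    using assms exp_L_integrable[of u s] by (intro nn_integral_eq_integral) auto
  also have "expectation (\<lambda>\<omega>. exp (- s * L u \<omega>) / s) = exp (- u * \<phi> s) / s"
    using L_laplace[of u s] assms by simp
  finally show ?thesis .
qed

text \<open>The probability that \<open>L\<close> at an independent Erlang time with \<open>k + 1\<close> stages of rate \<open>r\<close>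
  is at most \<open>t\<close>.\<close>

definition tail :: "real \<Rightarrow> nat \<Rightarrow> real \<Rightarrow> real" where
  "tail r k t = (LINT u|lborel. erlang_density k r u * passage u t)"

lemma erlang_integrable:
  assumes "0 < r"
  shows "integrable lborel (erlang_density k r)"
proof (rule integrableI_bounded)
  have "(\<integral>\<^sup>+u. ennreal (norm (erlang_density k r u)) \<partial>lborel) = 1"
    using nn_integral_erlang_ith_moment[OF assms, of k 0] assms by simp
  then show "(\<integral>\<^sup>+u. ennreal (norm (erlang_density k r u)) \<partial>lborel) < \<infinity>" by simp
qed simp

lemma tail_integrable:
  assumes "0 < r"
  shows "integrable lborel (\<lambda>u. erlang_density k r u * passage u t)"
  by (rule Bochner_Integration.integrable_bound[OF erlang_integrable[OF assms, of k]])
     (use assms passage_bounds in \<open>auto intro!: AE_I2 mult_left_le simp: abs_mult\<close>)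

lemma ennreal_tail:
  assumes "0 < r"
  shows "ennreal (tail r k t) = (\<integral>\<^sup>+u. ennreal (erlang_density k r u) * ennreal (passage u t) \<partial>lborel)"
  using tail_integrable[OF assms] assms passage_bounds unfolding tail_def
  by (subst nn_integral_eq_integral[symmetric]) (auto simp: ennreal_mult)

text \<open>Dominated convergence with the Erlang density as majorant, since \<open>passage\<close>
  is at most 1 and right-continuous in \<open>t\<close>.\<close>

lemma tail_right_continuous:
  assumes "0 < r"
  shows "continuous (at_right t) (tail r k)"
  unfolding continuous_within_sequentially
proof (intro allI impI, elim conjE)
  fix X :: "nat \<Rightarrow> real" assume X: "\<forall>n. X n \<in> {t<..}" "X \<longlonglongrightarrow> t"
  have lim: "(\<lambda>n. passage u (X n)) \<longlonglongrightarrow> passage u t" for u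
    using passage_right_continuous[of t u] X unfolding continuous_within_sequentially comp_def by blast
  show "(tail r k \<circ> X) \<longlonglongrightarrow> tail r k t"
    unfolding tail_def comp_def
    by (rule integral_dominated_convergence[OF _ _ erlang_integrable[OF assms, of k]])
       (use assms passage_bounds in \<open>auto intro!: AE_I2 tendsto_mult lim mult_left_le simp: abs_mult\<close>)
qed

text \<open>Exponential tilting: the Erlang density of rate \<open>r\<close> times
  \<open>exp (- u * \<phi> s)\<close> is \<open>(r / (r + \<phi> s)) ^ Suc k\<close> times the
  Erlang density of rate \<open>r + \<phi> s\<close>, which integrates to 1. The factor
  \<open>1 / s\<close> comes from \<open>passage_laplace\<close>.\<close>

lemma tail_has_laplace:
  assumes r: "0 < r" and s: "0 < s"
  shows "has_laplace (tail r k) s (1 / s * (r / (r + \<phi> s)) ^ Suc k)"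
  unfolding has_laplace_def
proof (rule has_bochner_integral_nn_integral)
  have [measurable]: "tail r k \<in> borel_measurable borel"
    unfolding tail_def by measurable
  show "(\<lambda>t. indicator {0<..} t * (exp (- s * t) * tail r k t)) \<in> borel_measurable lborel" by measurable
  have tail_nonneg: "0 \<le> tail r k t" for t
    unfolding tail_def using r passage_bounds by (intro Bochner_Integration.integral_nonneg) auto
  then show "AE t in lborel. 0 \<le> indicator {0<..} t * (exp (- s * t) * tail r k t)" by simp
  have pos: "0 < r + \<phi> s" using r \<phi>_nonneg[of s] by simp
  then show "0 \<le> 1 / s * (r / (r + \<phi> s)) ^ Suc k" using r s by simp
  have "(\<integral>\<^sup>+t. ennreal (indicator {0<..} t * (exp (- s * t) * tail r k t)) \<partial>lborel)
    = (\<integral>\<^sup>+t. (\<integral>\<^sup>+u. ennreal (indicator {0<..} t * exp (- s * t)) *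
        (ennreal (erlang_density k r u) * ennreal (passage u t)) \<partial>lborel) \<partial>lborel)"
  proof (rule nn_integral_cong)
    fix t :: real
    have "ennreal (indicator {0<..} t * (exp (- s * t) * tail r k t)) =
        ennreal (indicator {0<..} t * exp (- s * t)) * ennreal (tail r k t)"
      using tail_nonneg[of t] by (simp add: mult.assoc flip: ennreal_mult)
    also have "\<dots> = (\<integral>\<^sup>+u. ennreal (indicator {0<..} t * exp (- s * t)) *
        (ennreal (erlang_density k r u) * ennreal (passage u t)) \<partial>lborel)"
      unfolding ennreal_tail[OF r] by (rule nn_integral_cmult[symmetric]) measurable
    finally show "ennreal (indicator {0<..} t * (exp (- s * t) * tail r k t)) =
      (\<integral>\<^sup>+u. ennreal (indicator {0<..} t * exp (- s * t)) *
        (ennreal (erlang_density k r u) * ennreal (passage u t)) \<partial>lborel)" .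
  qed
  also have "\<dots> = (\<integral>\<^sup>+u. (\<integral>\<^sup>+t. ennreal (indicator {0<..} t * exp (- s * t)) *
        (ennreal (erlang_density k r u) * ennreal (passage u t)) \<partial>lborel) \<partial>lborel)"
    by (rule lborel_pair.Fubini') measurable
  also have "\<dots> = (\<integral>\<^sup>+u. ennreal (1 / s * (r / (r + \<phi> s)) ^ Suc k) * ennreal (erlang_density k (r + \<phi> s) u) \<partial>lborel)"
  proof (rule nn_integral_cong)
    fix u :: real
    have "(\<integral>\<^sup>+t. ennreal (indicator {0<..} t * exp (- s * t)) *
        (ennreal (erlang_density k r u) * ennreal (passage u t)) \<partial>lborel)
      = ennreal (erlang_density k r u) *
        (\<integral>\<^sup>+t. ennreal (indicator {0<..} t * exp (- s * t)) * ennreal (passage u t) \<partial>lborel)"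
      by (subst nn_integral_cmult[symmetric]) (auto simp: mult_ac)
    also have "\<dots> = ennreal (1 / s * (r / (r + \<phi> s)) ^ Suc k) * ennreal (erlang_density k (r + \<phi> s) u)"
    proof (cases "0 \<le> u")
      case True
      have "erlang_density k r u * (exp (- u * \<phi> s) / s) =
          (1 / s * (r / (r + \<phi> s)) ^ Suc k) * erlang_density k (r + \<phi> s) u"
      proof -
        have "exp (- (r + \<phi> s) * u) = exp (- r * u) * exp (- u * \<phi> s)"
          by (simp add: algebra_simps flip: exp_add)
        then show ?thesis using True pos by (simp add: erlang_density_def power_divide mult_ac)
      qed
      then show ?thesis
        using passage_laplace[OF True s] r s pos by (simp flip: ennreal_mult)
    qed (simp add: erlang_density_def)
    finally show "(\<integral>\<^sup>+t. ennreal (indicator {0<..} t * exp (- s * t)) *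
        (ennreal (erlang_density k r u) * ennreal (passage u t)) \<partial>lborel)
      = ennreal (1 / s * (r / (r + \<phi> s)) ^ Suc k) * ennreal (erlang_density k (r + \<phi> s) u)" .
  qed
  also have "\<dots> = ennreal (1 / s * (r / (r + \<phi> s)) ^ Suc k)"
    using nn_integral_erlang_ith_moment[OF pos, of k 0] by (subst nn_integral_cmult) auto
  finally show "(\<integral>\<^sup>+t. ennreal (indicator {0<..} t * (exp (- s * t) * tail r k t)) \<partial>lborel)
    = ennreal (1 / s * (r / (r + \<phi> s)) ^ Suc k)" .
qed

text \<open>The Erlang distribution function at \<open>Z\<close> is the integral of its density over
  \<open>u \<le> Z\<close>, and Tonelli brings out \<open>P(u \<le> Z)\<close>. This agrees with
  \<open>passage u t\<close> unless \<open>u\<close> is an atom of \<open>Z\<close>, and there are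
  only countably many atoms.\<close>

lemma expectation_erlang_CDF:
  assumes r: "0 < r" and Y [measurable]: "inverse_subordinator L t \<in> borel_measurable M"
  shows "expectation (\<lambda>\<omega>. erlang_CDF k r (real_of_ereal (inverse_subordinator L t \<omega>))) = tail r k t"
proof -
  interpret P: pair_sigma_finite M lborel ..
  define Z where "Z = (\<lambda>\<omega>. real_of_ereal (inverse_subordinator L t \<omega>))"
  have [measurable]: "Z \<in> borel_measurable M" unfolding Z_def by measurable
  interpret D: finite_measure "distr M borel Z" by (intro finite_measure_distr) simp
  have [measurable]: "erlang_CDF k r \<in> borel_measurable borel"
    unfolding erlang_CDF_def[abs_def] by measurable
  have CDF: "0 \<le> erlang_CDF k r z" "erlang_CDF k r z \<le> 1" for z
    using r erlang_CDF_nonneg[OF r] by (auto simp: erlang_CDF_def intro!: sum_nonneg)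
  have "AE u in lborel. u \<notin> {u. measure (distr M borel Z) {u} \<noteq> 0}"
    by (intro AE_not_in countable_imp_null_set_lborel D.countable_support)
  then have AE: "AE u in lborel. 0 \<le> u \<longrightarrow> prob {\<omega> \<in> space M. u \<le> Z \<omega>} = passage u t"
  proof eventually_elim
    case (elim u)
    show ?case
    proof
      assume u: "0 \<le> u"
      have "measure (distr M borel Z) {u} = 0" using elim by simp
      then have "prob {\<omega> \<in> space M. Z \<omega> = u} = 0"
        by (subst (asm) measure_distr) (auto simp: vimage_def Int_def conj_commute)
      then have "{\<omega> \<in> space M. Z \<omega> = u} \<in> null_sets M"
        by (simp add: null_sets_def emeasure_eq_measure)
      from AE_not_in[OF this] AE_inverse_subordinator_finite[of t]
      have "AE \<omega> in M. (\<omega> \<in> {\<omega> \<in> space M. u \<le> Z \<omega>}) = (\<omega> \<in> {\<omega> \<in> space M. L (max 0 u) \<omega> \<le> t})"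
      proof eventually_elim
        case (elim \<omega>)
        then show ?case
          using u less_inverse_subordinatorD[of u t \<omega>] le_inverse_subordinatorI[of \<omega> u t]
          by (auto simp: Z_def order_le_less)
      qed
      then show "prob {\<omega> \<in> space M. u \<le> Z \<omega>} = passage u t"
        unfolding passage_def by (rule finite_measure_eq_AE) measurable
    qed
  qed
  have "ennreal (expectation (\<lambda>\<omega>. erlang_CDF k r (Z \<omega>))) = (\<integral>\<^sup>+\<omega>. ennreal (erlang_CDF k r (Z \<omega>)) \<partial>M)"
    using CDF by (intro nn_integral_eq_integral[symmetric] integrable_const_bound[where B=1]) auto
  also have "\<dots> = (\<integral>\<^sup>+\<omega>. (\<integral>\<^sup>+u. ennreal (erlang_density k r u) * indicator {..Z \<omega>} u \<partial>lborel) \<partial>M)"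
    by (simp add: nn_integral_erlang_density[OF r])
  also have "\<dots> = (\<integral>\<^sup>+u. (\<integral>\<^sup>+\<omega>. ennreal (erlang_density k r u) * indicator {..Z \<omega>} u \<partial>M) \<partial>lborel)"
    unfolding indicator_def atMost_def mem_Collect_eq by (rule P.Fubini'[symmetric]) measurable
  also have "\<dots> = (\<integral>\<^sup>+u. ennreal (erlang_density k r u) * ennreal (passage u t) \<partial>lborel)"
  proof (rule nn_integral_cong_AE, use AE in eventually_elim)
    case (elim u)
    have "(\<integral>\<^sup>+\<omega>. ennreal (erlang_density k r u) * indicator {..Z \<omega>} u \<partial>M)
      = (\<integral>\<^sup>+\<omega>. ennreal (erlang_density k r u) * indicator {\<omega> \<in> space M. u \<le> Z \<omega>} \<omega> \<partial>M)"
      by (intro nn_integral_cong) (auto split: split_indicator)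
    also have "\<dots> = ennreal (erlang_density k r u) * emeasure M {\<omega> \<in> space M. u \<le> Z \<omega>}"
      by (intro nn_integral_cmult_indicator) measurable
    \<comment> \<open>For negative \<open>u\<close> both sides vanish with the Erlang
      density.\<close>
    also have "\<dots> = ennreal (erlang_density k r u) * ennreal (passage u t)"
      using elim by (cases "0 \<le> u") (auto simp: emeasure_eq_measure erlang_density_def)
    finally show ?case .
  qed
  also have "\<dots> = ennreal (tail r k t)" using ennreal_tail[OF r] by simp
  finally have "expectation (\<lambda>\<omega>. erlang_CDF k r (Z \<omega>)) = tail r k t"
    using CDF r passage_bounds unfolding tail_def
    by (subst (asm) ennreal_inj) (auto intro!: Bochner_Integration.integral_nonneg)
  then show ?thesis by (simp add: Z_def)
qed

end

section \<open>The fractional equation for the tails, and the law of the time-changed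
  process\<close>

context mixed_stable_clock
begin

text \<open>Multiplying \<open>r * (1 - G s) = \<phi> s * G s\<close> by \<open>G s ^ k / s\<close>
  gives the equations for all \<open>k\<close> from one identity. The properties are obtained
  together because the same \<open>F k\<close> must serve as derivative and as convolution
  factor.\<close>

lemma tail_fractional_equation:
  assumes r: "0 < r" and \<alpha>: "0 < \<alpha>\<^sub>1" "\<alpha>\<^sub>1 < \<alpha>\<^sub>2" "\<alpha>\<^sub>2 < 1"
  obtains F :: "nat \<Rightarrow> real \<Rightarrow> real" where
    "\<And>k. weakly_singular \<alpha>\<^sub>2 (F k)"
    "\<And>k t. 0 < t \<Longrightarrow> (tail r k has_real_derivative F k t) (at t)"
    "\<And>k. tail r k 0 = 0"
    "\<And>k t. 0 < t \<Longrightarrow>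
      C\<^sub>1 * conv (F k) (caputo_kernel \<alpha>\<^sub>1) t + C\<^sub>2 * conv (F k) (caputo_kernel \<alpha>\<^sub>2) t =
      r * ((if k = 0 then 1 else tail r (k - 1) t) - tail r k t)"
proof -
  define G where "G = (\<lambda>s. r / (r + \<phi> s))"
  have \<alpha>2: "0 < \<alpha>\<^sub>2" using \<alpha> by simp
  obtain f s0 where f: "0 < s0" "weakly_singular \<alpha>\<^sub>2 f" "\<And>s. s0 \<le> s \<Longrightarrow> has_laplace f s (G s)"
    using exists_weakly_singular_has_laplace[OF \<alpha>(1,2) coeffs(1,2) r] unfolding G_def \<phi>_def by blast
  have "\<exists>F. \<forall>k. weakly_singular \<alpha>\<^sub>2 (F k) \<and> (\<forall>s\<ge>s0. has_laplace (F k) s (G s ^ Suc k))"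
    using exists_has_laplace_power[OF \<alpha>2 f(2,3)] by (intro choice allI)
  then obtain F where F: "\<And>k. weakly_singular \<alpha>\<^sub>2 (F k)"
    "\<And>k s. s0 \<le> s \<Longrightarrow> has_laplace (F k) s (G s ^ Suc k)" by blast
  have s_pos: "0 < s" if "s0 \<le> s" for s using that f(1) by simp
  have conv1: "weakly_singular (\<alpha>\<^sub>2 + 1) (conv (F k) (\<lambda>_. 1))" for k
    using \<alpha>2 by (intro weakly_singular_conv F weakly_singular_one) auto
  have tail_laplace: "has_laplace (tail r k) s (1 / s * G s ^ Suc k)" if "s0 \<le> s" for k s
    using tail_has_laplace[OF r s_pos[OF that]] by (simp add: G_def)
  have tail_eq: "tail r k t = conv (F k) (\<lambda>_. 1) t" if "0 < t" for k t
  proof (rule laplace_unique[OF tail_laplace])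
    fix s assume s: "s0 \<le> s"
    show "has_laplace (conv (F k) (\<lambda>_. 1)) s (1 / s * G s ^ Suc k)"
      using has_laplace_conv[OF F(2)[OF s] has_laplace_one[OF s_pos[OF s]]] by (simp add: mult.commute)
  qed (use that weakly_singular_continuous_at[OF conv1 that] tail_right_continuous[OF r] in
        \<open>auto intro: continuous_within_subset[of _ UNIV]\<close>)
  show thesis
  proof (rule that[of F])
    show "weakly_singular \<alpha>\<^sub>2 (F k)" for k by (rule F)
    show "(tail r k has_real_derivative F k t) (at t)" if t: "0 < t" for k t
    proof (rule has_field_derivative_transform_within_open)
      show "(conv (F k) (\<lambda>_. 1) has_real_derivative F k t) (at t)"
        by (rule weakly_singular_conv_one_has_derivative[OF F(1) \<alpha>2 t])
      show "open {0::real<..}" "t \<in> {0<..}" using t by auto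
    qed (simp add: tail_eq)
    \<comment> \<open>For \<open>t > 0\<close> the tail is a convolution of exponent
      \<open>\<alpha>\<^sub>2 + 1\<close>, hence bounded by a multiple of
      \<open>t powr \<alpha>\<^sub>2\<close> near 0; right-continuity carries the limit 0 to the
      value at 0.\<close>
    show "tail r k 0 = 0" for k
    proof (rule tendsto_unique)
      show "(tail r k \<longlongrightarrow> tail r k 0) (at_right 0)"
        using tail_right_continuous[OF r, of 0 k] by (simp add: continuous_within)
      obtain C where C: "\<And>t. 0 < t \<Longrightarrow> t \<le> 1 \<Longrightarrow> \<bar>conv (F k) (\<lambda>_. 1) t\<bar> \<le> C * t powr (\<alpha>\<^sub>2 + 1 - 1)"
        using weakly_singularD[OF conv1, of 1 k] by auto
      have "((\<lambda>t::real. C * t powr \<alpha>\<^sub>2) \<longlongrightarrow> C * 0 powr \<alpha>\<^sub>2) (at_right 0)"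
        using \<alpha>2 by (intro tendsto_mult tendsto_const tendsto_powr' tendsto_ident_at)
          (auto simp: eventually_at_right_less intro: eventually_mono[OF eventually_at_right_less])
      then have lim: "((\<lambda>t::real. C * t powr \<alpha>\<^sub>2) \<longlongrightarrow> 0) (at_right 0)" by simp
      show "(tail r k \<longlongrightarrow> 0) (at_right 0)"
      proof (rule Lim_null_comparison[OF _ lim])
        show "\<forall>\<^sub>F t in at_right 0. norm (tail r k t) \<le> C * t powr \<alpha>\<^sub>2"
          using C tail_eq by (auto simp: eventually_at_right_field intro!: exI[of _ 1])
      qed
    qed simp
    fix k and t :: real assume t: "0 < t"
    let ?A = "\<lambda>t. C\<^sub>1 * conv (F k) (caputo_kernel \<alpha>\<^sub>1) t + C\<^sub>2 * conv (F k) (caputo_kernel \<alpha>\<^sub>2) t"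
    \<comment> \<open>For \<open>k = 0\<close> the preceding tail is that of the certain event,
      whose transform \<open>1 / s\<close> fits the pattern \<open>1 / s * G s ^ k\<close>.\<close>
    let ?V = "\<lambda>t. if k = 0 then 1 else tail r (k - 1) t"
    have A_cont: "isCont ?A t"
    proof -
      have "isCont (conv (F k) (caputo_kernel \<alpha>)) t" if "\<alpha> < 1" for \<alpha>
        using weakly_singular_conv(1)[OF F(1) weakly_singular_caputo_kernel \<alpha>2] that t
        by (intro weakly_singular_continuous_at) auto
      then show ?thesis using \<alpha> by (intro continuous_intros) auto
    qed
    show "?A t = r * (?V t - tail r k t)"
    proof (rule laplace_unique[where f = "?A" and t = t])
      fix s assume s: "s0 \<le> s"
      have "has_laplace ?A s (C\<^sub>1 * (G s ^ Suc k * (s powr \<alpha>\<^sub>1 / s)) + C\<^sub>2 * (G s ^ Suc k * (s powr \<alpha>\<^sub>2 / s)))"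
        using \<alpha> by (intro has_laplace_add has_laplace_cmult has_laplace_conv F(2) s has_laplace_caputo_kernel s_pos) auto
      also have "C\<^sub>1 * (G s ^ Suc k * (s powr \<alpha>\<^sub>1 / s)) + C\<^sub>2 * (G s ^ Suc k * (s powr \<alpha>\<^sub>2 / s)) =
          \<phi> s / s * G s ^ Suc k"
        by (simp add: \<phi>_def add_divide_distrib algebra_simps)
      finally show "has_laplace ?A s (\<phi> s / s * G s ^ Suc k)" .
      have "has_laplace ?V s (1 / s * G s ^ k)"
        using tail_laplace[OF s, of "k - 1"] has_laplace_one[OF s_pos[OF s]] by (cases k) auto
      then have "has_laplace (\<lambda>t. r * (?V t - tail r k t)) s (r * (1 / s * G s ^ k - 1 / s * G s ^ Suc k))"
        by (intro has_laplace_cmult has_laplace_diff tail_laplace s)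
      also have "r * (1 / s * G s ^ k - 1 / s * G s ^ Suc k) = 1 / s * G s ^ k * (r * (1 - G s))"
        by (simp add: right_diff_distrib diff_divide_distrib mult_ac)
      also have "r * (1 - G s) = \<phi> s * G s"
        using r \<phi>_nonneg[of s] by (simp add: G_def field_simps)
      also have "1 / s * G s ^ k * (\<phi> s * G s) = \<phi> s / s * G s ^ Suc k"
        by simp
      finally show "has_laplace (\<lambda>t. r * (?V t - tail r k t)) s (\<phi> s / s * G s ^ Suc k)" .
    next
      show "continuous (at_right t) ?A" using A_cont by (rule continuous_within_subset) simp
      show "continuous (at_right t) (\<lambda>t. r * (?V t - tail r k t))"
        using tail_right_continuous[OF r] by (cases "k = 0") (auto intro!: continuous_intros)
    qed (use t in simp)
  qed
qed

text \<open>The Poisson weight of \<open>k\<close> is the probability that the \<open>k\<close>-th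
  jump has occurred and the next has not, a difference of Erlang distribution functions with indices
  \<open>k - 1\<close> and \<open>k\<close>. Averaging over the independent clock turns each into a
  tail.\<close>

lemma state_prob_time_changed:
  assumes r: "0 < r" and N: "poisson_process M r N"
    and indep: "independent_processes M (count_space UNIV) N borel (inverse_subordinator L)"
    and t: "0 \<le> t"
  shows "state_prob M (time_changed N (inverse_subordinator L)) (int k) t =
    (if k = 0 then 1 else tail r (k - 1) t) - tail r k t"
proof -
  define Z where "Z = (\<lambda>\<omega>. real_of_ereal (inverse_subordinator L t \<omega>))"
  let ?S = "\<lambda>A X. sets (vimage_algebra (space M) (\<lambda>\<omega>. \<lambda>t\<in>{0..}. X t \<omega>) (PiM {0::real..} (\<lambda>_. A)))"
  \<comment> \<open>Events at a single time lie in the sigma-algebra generated by the whole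
    path.\<close>
  have event: "{\<omega> \<in> space M. X u \<omega> \<in> B} \<in> ?S A X" if "space A = UNIV" "0 \<le> u" "B \<in> sets A"
    for A :: "'b measure" and X u B
  proof -
    have "(\<lambda>x. x u) \<in> measurable (PiM {0..} (\<lambda>_. A)) A"
      using that by (intro measurable_component_singleton) auto
    from in_vimage_algebra[OF measurable_sets[OF this that(3)], of "\<lambda>\<omega>. \<lambda>t\<in>{0..}. X t \<omega>" "space M"]
    have "(\<lambda>\<omega>. \<lambda>t\<in>{0..}. X t \<omega>) -` ((\<lambda>x. x u) -` B \<inter> space (PiM {0..} (\<lambda>_. A))) \<inter> space M \<in> ?S A X" .
    also have "(\<lambda>\<omega>. \<lambda>t\<in>{0..}. X t \<omega>) -` ((\<lambda>x. x u) -` B \<inter> space (PiM {0..} (\<lambda>_. A))) \<inter> space M =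
        {\<omega> \<in> space M. X u \<omega> \<in> B}"
      using that by (auto simp: space_PiM)
    finally show ?thesis .
  qed
  have indep': "indep_set (?S (count_space UNIV) N) (?S borel (inverse_subordinator L))"
    using indep unfolding independent_processes_def .
  \<comment> \<open>Independence of the generated sigma-algebras includes their containment in
    \<open>events\<close>; this is the source of the measurability of the clock.\<close>
  have Y [measurable]: "inverse_subordinator L t \<in> borel_measurable M"
  proof (rule measurableI)
    fix B :: "ereal set" assume "B \<in> sets borel"
    then have "{\<omega> \<in> space M. inverse_subordinator L t \<omega> \<in> B} \<in> events"
      using event[of borel t B "inverse_subordinator L"] indep_setD_ev2[OF indep'] t by auto
    then show "inverse_subordinator L t -` B \<inter> space M \<in> events"
      by (simp add: vimage_def Int_def conj_commute)
  qed simp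
  have Z [measurable]: "Z \<in> borel_measurable M" unfolding Z_def by measurable
  have indep_Z: "prob ({\<omega> \<in> space M. N u \<omega> = k} \<inter> {\<omega> \<in> space M. Z \<omega> \<in> A}) =
      prob {\<omega> \<in> space M. N u \<omega> = k} * prob {\<omega> \<in> space M. Z \<omega> \<in> A}"
    if "0 < u" "A \<in> sets borel" for u k A
  proof -
    have "real_of_ereal -` A \<in> sets borel"
      using measurable_sets[OF borel_measurable_real_of_ereal[OF measurable_ident] that(2)] by simp
    then have "{\<omega> \<in> space M. inverse_subordinator L t \<omega> \<in> real_of_ereal -` A} \<in> ?S borel (inverse_subordinator L)"
      using t by (intro event) auto
    moreover have "{\<omega> \<in> space M. N u \<omega> \<in> {k}} \<in> ?S (count_space UNIV) N"
      using that by (intro event) auto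
    ultimately show ?thesis
      using indep_setD[OF indep'] by (simp add: Z_def)
  qed
  define q where "q = (\<lambda>k \<omega>. (r * Z \<omega>) ^ k / fact k * exp (- (r * Z \<omega>)))"
  have Z_nonneg: "0 \<le> Z \<omega>" for \<omega> unfolding Z_def by (rule real_inverse_subordinator_nonneg)
  have CDF_bounds: "0 \<le> erlang_CDF k r z" "erlang_CDF k r z \<le> 1" for k z
    using r erlang_CDF_nonneg[OF r] by (auto simp: erlang_CDF_def intro!: sum_nonneg)
  have [measurable]: "erlang_CDF k r \<in> borel_measurable borel" for k
    unfolding erlang_CDF_def[abs_def] by measurable
  have CDF_int: "integrable M (\<lambda>\<omega>. erlang_CDF k r (Z \<omega>))" for k
    using CDF_bounds by (intro integrable_const_bound[where B=1]) auto
  have tail: "expectation (\<lambda>\<omega>. erlang_CDF k r (Z \<omega>)) = tail r k t" for k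
    using expectation_erlang_CDF[OF r Y] by (simp add: Z_def)
  have "state_prob M (time_changed N (inverse_subordinator L)) (int k) t = prob {\<omega> \<in> space M. N (Z \<omega>) \<omega> = k}"
    by (simp add: state_prob_def time_changed_def Z_def)
  also have "\<dots> = expectation (q k)"
    unfolding q_def by (rule poisson_process_at_independent_time[OF N r Z Z_nonneg indep_Z])
  also have "\<dots> = (if k = 0 then 1 else tail r (k - 1) t) - tail r k t"
  proof (cases k)
    case 0
    have "q 0 \<omega> = 1 - erlang_CDF 0 r (Z \<omega>)" for \<omega>
      using Z_nonneg[of \<omega>] by (simp add: q_def erlang_CDF_def)
    then have "expectation (q 0) = expectation (\<lambda>\<omega>. 1 - erlang_CDF 0 r (Z \<omega>))" by presburger
    also have "\<dots> = 1 - tail r 0 t" using CDF_int by (simp add: tail prob_space)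
    finally show ?thesis using 0 by simp
  next
    case (Suc j)
    have "q (Suc j) \<omega> = erlang_CDF j r (Z \<omega>) - erlang_CDF (Suc j) r (Z \<omega>)" for \<omega>
      using Z_nonneg[of \<omega>] by (simp add: q_def erlang_CDF_def)
    then have "expectation (q (Suc j)) = expectation (\<lambda>\<omega>. erlang_CDF j r (Z \<omega>) - erlang_CDF (Suc j) r (Z \<omega>))"
      by presburger
    also have "\<dots> = tail r j t - tail r (Suc j) t" using CDF_int by (simp add: tail)
    finally show ?thesis using Suc by simp
  qed
  finally show ?thesis .
qed

end

section \<open>From tails to state probabilities by differencing in the state\<close>

theorem theorem3p1:
  fixes M :: "'a measure"
    and L :: "real \<Rightarrow> 'a \<Rightarrow> real"
    and N :: "real \<Rightarrow> 'a \<Rightarrow> nat"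
    and p :: "int \<Rightarrow> real \<Rightarrow> real"
    and \<alpha>\<^sub>1 \<alpha>\<^sub>2 C\<^sub>1 C\<^sub>2 r :: real
  assumes "0 < \<alpha>\<^sub>1" "\<alpha>\<^sub>1 < \<alpha>\<^sub>2" "\<alpha>\<^sub>2 < 1"
    and "0 \<le> C\<^sub>1" "0 < C\<^sub>2" "C\<^sub>1 + C\<^sub>2 = 1"
    and "0 < r"
    and "mixed_stable_subordinator M \<alpha>\<^sub>1 \<alpha>\<^sub>2 C\<^sub>1 C\<^sub>2 L"
    and "poisson_process M r N"
    and "independent_processes M (count_space UNIV) N borel (inverse_subordinator L)"
    and p_def: "\<And>k t. p k t = state_prob M (time_changed N (inverse_subordinator L)) k t"
  shows "(\<forall>(k::nat) t. 0 < t \<longrightarrow>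
            caputo_differentiable \<alpha>\<^sub>1 (p (int k)) t \<and>
            caputo_differentiable \<alpha>\<^sub>2 (p (int k)) t \<and>
            C\<^sub>1 * caputo \<alpha>\<^sub>1 (p (int k)) t + C\<^sub>2 * caputo \<alpha>\<^sub>2 (p (int k)) t =
              - r * (p (int k) t - p (int k - 1) t)) \<and>
         p 0 0 = 1 \<and>
         (\<forall>k::nat. 1 \<le> k \<longrightarrow> p (int k) 0 = 0) \<and>
         (\<forall>t\<ge>0. p (- 1) t = 0)"
proof -
  interpret prob_space M
    using assms(9) by (simp add: poisson_process_def levy_process_def)
  interpret mixed_stable_clock M L \<alpha>\<^sub>1 \<alpha>\<^sub>2 C\<^sub>1 C\<^sub>2
    by unfold_locales fact+
  obtain F where F: "\<And>k. weakly_singular \<alpha>\<^sub>2 (F k)"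
    "\<And>k t. 0 < t \<Longrightarrow> (tail r k has_real_derivative F k t) (at t)"
    "\<And>k. tail r k 0 = 0"
    "\<And>k t. 0 < t \<Longrightarrow>
      C\<^sub>1 * conv (F k) (caputo_kernel \<alpha>\<^sub>1) t + C\<^sub>2 * conv (F k) (caputo_kernel \<alpha>\<^sub>2) t =
      r * ((if k = 0 then 1 else tail r (k - 1) t) - tail r k t)"
    using tail_fractional_equation[OF \<open>0 < r\<close> assms(1-3)] by blast
  have \<alpha>: "0 < \<alpha>\<^sub>2" "\<alpha>\<^sub>1 < 1" "\<alpha>\<^sub>2 < 1" using assms by auto
  \<comment> \<open>\<open>V k\<close> is the probability of at least \<open>k\<close> jumps: the
    index of \<open>tail\<close> is shifted by one so that \<open>V 0 = 1\<close>.\<close>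
  define V where "V = (\<lambda>k t. if k = 0 then 1 else tail r (k - 1) t)"
  define v where "v = (\<lambda>k t. if k = 0 then 0 else F (k - 1) t)"
  have p_V: "p (int k) t = V k t - V (Suc k) t" if "0 \<le> t" for k t
    using state_prob_time_changed[OF assms(7,9,10) that] by (simp add: p_def V_def)
  have p_neg: "p (- 1) t = 0" for t
    by (simp add: p_def state_prob_def)
  have v: "weakly_singular \<alpha>\<^sub>2 (v k)" for k
  proof (cases k)
    case 0
    then show ?thesis by (auto simp: v_def weakly_singular_def intro!: exI[of _ 0])
  qed (simp add: v_def F(1))
  have V_deriv: "(V k has_real_derivative v k t) (at t)" if "0 < t" for k t
    using F(2)[OF that, of "k - 1"] by (cases k) (simp_all add: V_def v_def)
  \<comment> \<open>The guard at \<open>k = 0\<close> avoids the truncated \<open>k - 1\<close>;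
    there \<open>V 0\<close> is constant and both sides are 0.\<close>
  have v_eq: "C\<^sub>1 * conv (v k) (caputo_kernel \<alpha>\<^sub>1) t + C\<^sub>2 * conv (v k) (caputo_kernel \<alpha>\<^sub>2) t =
      r * ((if k = 0 then 0 else V (k - 1) t - V k t))" if "0 < t" for k t
  proof (cases k)
    case 0
    then show ?thesis by (simp add: v_def conv_def)
  next
    case (Suc j)
    then show ?thesis using F(4)[OF that, of j] by (simp add: v_def V_def)
  qed
  \<comment> \<open>Positive times are covered by differentiability; at 0, the left end of the
    interval, right-continuity is what is required.\<close>
  have V_cont: "continuous_on {0..t} (V k)" for k t
  proof (cases k)
    case (Suc j)
    have "continuous_on {0..} (tail r j)"
      unfolding continuous_on_eq_continuous_within
    proof
      fix x :: real assume "x \<in> {0..}"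
      then consider "x = 0" | "0 < x" by fastforce
      then show "continuous (at x within {0..}) (tail r j)"
      proof cases
        case 1
        then show ?thesis
          using tail_right_continuous[OF assms(7), of 0 j] by (simp add: at_within_Ici_at_right)
      next
        case 2
        then show ?thesis
          using DERIV_isCont[OF F(2)] continuous_at_imp_continuous_at_within by blast
      qed
    qed
    then show ?thesis using Suc by (auto simp: V_def[abs_def] intro: continuous_on_subset)
  qed (simp add: V_def[abs_def])
  define w where "w = (\<lambda>k t. v k t - v (Suc k) t)"
  have p_deriv: "(p (int k) has_real_derivative w k t) (at t)" if "0 < t" for k t
  proof (rule has_field_derivative_transform_within_open)
    show "((\<lambda>t. V k t - V (Suc k) t) has_real_derivative w k t) (at t)"
      unfolding w_def using V_deriv[OF that] by (intro DERIV_diff)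
    show "open {0::real<..}" "t \<in> {0<..}" using that by auto
  qed (simp add: p_V)
  have w: "weakly_singular \<alpha>\<^sub>2 (w k)" for k
    unfolding w_def by (rule weakly_singular_diff[OF v v])
  have conv_w: "conv (w k) (caputo_kernel \<alpha>) t =
      conv (v k) (caputo_kernel \<alpha>) t - conv (v (Suc k)) (caputo_kernel \<alpha>) t"
    if "\<alpha> < 1" "0 < t" for \<alpha> k t
  proof -
    have int: "set_integrable lborel {0<..<t} (\<lambda>x. v k x * caputo_kernel \<alpha> (t - x))" for k
      by (rule weakly_singular_conv(2)[OF v _ \<alpha>(1) _ that(2), of "1 - \<alpha>"])
         (use that in \<open>auto intro: weakly_singular_caputo_kernel\<close>)
    show ?thesis
      unfolding conv_def w_def left_diff_distrib by (intro set_integral_diff(2) int)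
  qed
  have diff: "caputo_differentiable \<alpha> (p (int k)) t" if "\<alpha> < 1" "0 < t" for \<alpha> k t
    unfolding caputo_differentiable_def
  proof (intro conjI ballI)
    have "continuous_on {0..t} (\<lambda>t. V k t - V (Suc k) t)"
      by (intro continuous_on_diff V_cont)
    then show "continuous_on {0..t} (p (int k))"
      by (rule continuous_on_eq) (simp add: p_V)
    show "p (int k) differentiable (at \<tau>)" if "\<tau> \<in> {0<..<t}" for \<tau>
      unfolding real_differentiable_def using p_deriv[of \<tau> k] that by auto
    show "set_integrable lborel {0<..<t} (\<lambda>\<tau>. deriv (p (int k)) \<tau> / (t - \<tau>) powr \<alpha>)"
      by (rule caputo_eq_conv(1)[OF w \<alpha>(1) that p_deriv])
  qed
  have eq: "C\<^sub>1 * caputo \<alpha>\<^sub>1 (p (int k)) t + C\<^sub>2 * caputo \<alpha>\<^sub>2 (p (int k)) t =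
      - r * (p (int k) t - p (int k - 1) t)" if t: "0 < t" for k t
  proof -
    have caputo_p: "caputo \<alpha> (p (int k)) t = conv (v k) (caputo_kernel \<alpha>) t - conv (v (Suc k)) (caputo_kernel \<alpha>) t"
      if "\<alpha> < 1" for \<alpha>
      using caputo_eq_conv(2)[OF w \<alpha>(1) that t p_deriv] conv_w[OF that t] by simp
    have "C\<^sub>1 * caputo \<alpha>\<^sub>1 (p (int k)) t + C\<^sub>2 * caputo \<alpha>\<^sub>2 (p (int k)) t =
      (C\<^sub>1 * conv (v k) (caputo_kernel \<alpha>\<^sub>1) t + C\<^sub>2 * conv (v k) (caputo_kernel \<alpha>\<^sub>2) t) -
      (C\<^sub>1 * conv (v (Suc k)) (caputo_kernel \<alpha>\<^sub>1) t + C\<^sub>2 * conv (v (Suc k)) (caputo_kernel \<alpha>\<^sub>2) t)"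
      unfolding caputo_p[OF \<alpha>(2)] caputo_p[OF \<alpha>(3)] by (simp add: algebra_simps)
    also have "\<dots> = r * (if k = 0 then 0 else V (k - 1) t - V k t) - r * (V k t - V (Suc k) t)"
      unfolding v_eq[OF t] by simp
    \<comment> \<open>\<open>V (k - 1) - V k\<close> and \<open>V k - V (Suc k)\<close> are the
      probabilities of the states \<open>k - 1\<close> and \<open>k\<close>; at \<open>k = 0\<close>
      the first is replaced by 0, in accordance with \<open>p_neg\<close>.\<close>
    also have "\<dots> = - r * (p (int k) t - p (int k - 1) t)"
    proof (cases k)
      case 0
      then show ?thesis using p_V[of t 0] p_neg t by simp
    next
      case (Suc j)
      have "int k - 1 = int j" using Suc by simp
      then have p_eq: "p (int k) t = V k t - V (Suc k) t" "p (int k - 1) t = V j t - V k t"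
        using p_V[of t k] p_V[of t j] Suc t by auto
      show ?thesis unfolding p_eq using Suc by (simp add: algebra_simps)
    qed
    finally show ?thesis .
  qed
  have V0: "V 0 0 = 1" "V (Suc k) 0 = 0" for k by (simp_all add: V_def F(3))
  have p_start: "p 0 0 = 1" using p_V[of 0 0] V0 by simp
  have p_start': "p (int k) 0 = 0" if "1 \<le> k" for k
    using p_V[of 0 k] V0(2)[of "k - 1"] V0(2)[of k] that by simp
  show ?thesis
    by (intro conjI allI impI diff eq \<alpha> p_neg p_start p_start') assumption+
qed

end
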